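(* Suppose that the matrix of $f\in\mathrm{Aut}(T^2)$ is $A_f=\begin{pmatrix} a & c\\ b & d\end{pmatrix}\in GL(2,\mathbb{Z})$, and for $j/k\in\{1/0,0/1,1/1\}$ let $l_{j/k}=\inf\{d(v,f(v)):v\in V_{j/k}\}$. (i) If $a$ is odd and $b$ is even, then $$l_{1/0}=\begin{cases}0,&\text{if } b(a+d)=0\text{ and } b/2\text{ is even};\\ 1,&\text{if } b(a+d)=0\text{ and } b/2\text{ is odd};\\ N(b(a+d),a^2+bc)-N(b,a),&\text{if } b(a+d)\neq 0;\end{cases}$$ otherwise $l_{1/0}=\infty$. (ii) If $c$ is even and $d$ is odd, then $$l_{0/1}=\begin{cases}0,&\text{if } c(a+d)=0\text{ and } c/2\text{ is even};\\ 1,&\text{if } c(a+d)=0\text{ and } c/2\text{ is odd};\\ N(c(a+d),bc+d^2)-N(c,d),&\text{if } c(a+d)\neq 0;\end{cases}$$ otherwise $l_{0/1}=\infty$. (iii) If $a+c$ and $b+d$ are both odd, then, writing $e=(b-a)(a+c)+(d-c)(b+d)$, $$l_{1/1}=\begin{cases}0,&\text{if } e=0\text{ and } (b+d-a-c)/2\text{ is even};\\ 1,&\text{if } e=0\text{ and } (b+d-a-c)/2\text{ is odd};\\ N(e,\,a(a+c)+c(b+d))-N(b+d-a-c,\,a+c),&\text{if } e\neq 0;\end{cases}$$ otherwise $l_{1/1}=\infty$.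
   Context: Slopes and curve complex. Fix oriented simple closed curves $\lambda,\mu$ on the torus $T^2$ with $H_1(T^2;\mathbb{Z})=\mathbb{Z}\langle[\lambda]\rangle\oplus\mathbb{Z}\langle[\mu]\rangle$. An essential simple closed curve on $T^2$ has slope $p/q$ ($p,q$ coprime integers) if with some orientation it represents $p[\lambda]+q[\mu]$; isotopy classes of essential simple closed curves are identified with slopes in $\mathbb{Q}\cup\{\infty\}$ ($\infty=1/0$). $\mathcal{C}^{i=2}(T^2)$ is the graph with vertex set $\mathbb{Q}\cup\{\infty\}$ and an edge $\{p/q,p'/q'\}$ exactly when $|pq'-p'q|=2$. It has three connected components, all trees: $T_{j/k}$, $j/k\in\{1/0,0/1,1/1\}$, with vertex set $V_{j/k}=\{p/q: p\equiv j,\ q\equiv k \bmod 2\}$. $d(\cdot,\cdot)$ denotes graph distance ($\infty$ between different components). $\mathrm{Aut}(T^2)$ is the group of self-diffeomorphisms of $T^2$; $A_f\in GL(2,\mathbb{Z})$ is defined by $(f_*[\lambda]\ f_*[\mu])=([\lambda]\ [\mu])A_f$, and $f$ acts on $\mathcal{C}^{i=2}(T^2)$ through $A_f$, i.e. $f(p/q)=(ap+cq)/(bp+dq)$ for $A_f=\begin{pmatrix} a & c\\ b & d\end{pmatrix}$. The function $N(p,q)$. Let $p,q$ be nonzero coprime integers with $p$ even. Write the continued fraction $|p|/|q|=[a_0,a_1,\dots,a_n]=a_0+\cfrac{1}{a_1+\cfrac{1}{\ddots+\cfrac{1}{a_n}}}$ with integers $a_0\ge 0$, $a_1,\dots,a_{n-1}>0$,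 $a_n>1$. Put $b_0=a_0$ and for $i\ge1$ let $b_i=a_i$ if $b_{i-1}\ne a_{i-1}$ or $\sum_{j=0}^{i-1}b_j$ is odd, and $b_i=0$ if $b_{i-1}=a_{i-1}$ and $\sum_{j=0}^{i-1}b_j$ is even. Then $N(p,q)=\frac12\sum_{i=0}^n b_i$. (These $a_i,b_i$ are unrelated to the matrix entries.) Moreover $N(p,q)=\infty$ if $p$ is odd, and $N(0,\pm1)=0$. *)

theory Defs
  imports
    "HOL-Analysis.Analysis"
    "HOL-Homology.Homology"
    "Graph_Theory.Pair_Digraph"
    "Graph_Theory.Shortest_Path"
begin

section \<open>Diffeomorphisms of the torus and their matrices\<close>

definition torus :: "(complex \<times> complex) set"
  where "torus = sphere 0 1 \<times> sphere 0 1"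

text \<open>
  \<open>Ck k U f\<close>: on the open set \<open>U\<close>, \<open>f\<close> has continuous iterated directional derivatives
  of all orders up to \<open>k\<close>.
\<close>

primrec Ck :: "nat \<Rightarrow> 'a::euclidean_space set \<Rightarrow> ('a \<Rightarrow> 'b::euclidean_space) \<Rightarrow> bool"
  where
    "Ck 0 U f \<longleftrightarrow> continuous_on U f"
  | "Ck (Suc k) U f \<longleftrightarrow>
       (\<forall>x\<in>U. f differentiable (at x)) \<and> (\<forall>v. Ck k U (\<lambda>x. frechet_derivative f (at x) v))"

text \<open>A map on an embedded submanifold is smooth iff it extends smoothly to a neighbourhood.\<close>

definition smooth_map_on :: "'a::euclidean_space set \<Rightarrow> ('a \<Rightarrow> 'b::euclidean_space) \<Rightarrow> bool"
  where "smooth_map_on S f \<longleftrightarrow>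
    (\<exists>U F. open U \<and> S \<subseteq> U \<and> (\<forall>k. Ck k U F) \<and> (\<forall>x\<in>S. F x = f x))"

definition torus_diffeo :: "(complex \<times> complex \<Rightarrow> complex \<times> complex) \<Rightarrow> bool"
  where "torus_diffeo f \<longleftrightarrow>
    bij_betw f torus torus \<and> smooth_map_on torus f \<and> smooth_map_on torus (inv_into torus f)"

definition simple_closed_curve_on :: "'a::topological_space set \<Rightarrow> (real \<Rightarrow> 'a) \<Rightarrow> bool"
  where "simple_closed_curve_on S \<gamma> \<longleftrightarrow>
    simple_path \<gamma> \<and> pathfinish \<gamma> = pathstart \<gamma> \<and> path_image \<gamma> \<subseteq> S"

abbreviation torus_H1 :: "(complex \<times> complex) chain set monoid"
  where "torus_H1 \<equiv> homology_group 1 (top_of_set torus)"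

text \<open>
  The homology class of a closed curve, viewed as a singular 1-simplex: the point of the standard
  1-simplex with barycentric coordinates \<open>(1 - t, t)\<close> is sent to \<open>\<gamma> t\<close>.
\<close>

definition loop_class :: "(real \<Rightarrow> complex \<times> complex)
    \<Rightarrow> (complex \<times> complex) chain set"
  where "loop_class \<gamma> =
    homologous_rel_set 1 (top_of_set torus) {} (frag_of (\<lambda>x\<in>standard_simplex 1. \<gamma> (x 1)))"

text \<open>The class \<open>m[\<lambda>] + n[\<mu>]\<close>; the library writes homology groups multiplicatively.\<close>

definition lin_comb :: "(real \<Rightarrow> complex \<times> complex) \<Rightarrow> (real \<Rightarrow> complex \<times> complex)
    \<Rightarrow> int \<Rightarrow> int \<Rightarrow> (complex \<times> complex) chain set"
  where "lin_comb lam mu m n =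
    loop_class lam [^]\<^bsub>torus_H1\<^esub> m \<otimes>\<^bsub>torus_H1\<^esub> loop_class mu [^]\<^bsub>torus_H1\<^esub> n"

definition homology_basis :: "(real \<Rightarrow> complex \<times> complex) \<Rightarrow> (real \<Rightarrow> complex \<times> complex) \<Rightarrow> bool"
  where "homology_basis lam mu \<longleftrightarrow>
    (\<lambda>(m, n). lin_comb lam mu m n) \<in> iso (integer_group \<times>\<times> integer_group) torus_H1"

abbreviation induced_H1 :: "(complex \<times> complex \<Rightarrow> complex \<times> complex)
    \<Rightarrow> (complex \<times> complex) chain set
    \<Rightarrow> (complex \<times> complex) chain set"
  where "induced_H1 f \<equiv> hom_induced 1 (top_of_set torus) {} (top_of_set torus) {} f"

text \<open>The columns of the matrix are the coordinates of \<open>f\<^sub>*[\<lambda>]\<close> and \<open>f\<^sub>*[\<mu>]\<close>.\<close>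

definition homology_matrix :: "(real \<Rightarrow> complex \<times> complex) \<Rightarrow> (real \<Rightarrow> complex \<times> complex)
    \<Rightarrow> (complex \<times> complex \<Rightarrow> complex \<times> complex) \<Rightarrow> int^2^2"
  where "homology_matrix lam mu f = (THE A.
    induced_H1 f (loop_class lam) = lin_comb lam mu (A$1$1) (A$2$1) \<and>
    induced_H1 f (loop_class mu) = lin_comb lam mu (A$1$2) (A$2$2))"


section \<open>Slopes and the curve graph\<close>

datatype slope = Rational rat | Infinity

definition slope :: "int \<Rightarrow> int \<Rightarrow> slope"
  where "slope p q = (if q = 0 then Infinity else Rational (Fract p q))"

text \<open>The coprime pair \<open>(p, q)\<close> representing a slope, normalised by \<open>q > 0\<close> or \<open>(p, q) = (1, 0)\<close>.\<close>

fun slope_rep :: "slope \<Rightarrow> int \<times> int"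
  where
    "slope_rep (Rational r) = quotient_of r"
  | "slope_rep Infinity = (1, 0)"

lemma slope_slope_rep: "(case slope_rep s of (p, q) \<Rightarrow> slope p q) = s"
proof (cases s)
  case (Rational r)
  then show ?thesis
    using quotient_of_denom_pos[of r] quotient_of_div[of r]
    by (auto simp: slope_def Fract_of_int_quotient split: prod.split)
qed (simp add: slope_def)

lemma slope_rep_slope:
  assumes "coprime p q"
  shows "slope_rep (slope p q) = (p, q) \<or> slope_rep (slope p q) = (- p, - q)"
  using assms
  by (auto simp: slope_def quotient_of_Fract Rat.normalize_def Let_def coprime_iff_gcd_eq_1)

definition curve_graph :: "slope pair_pre_digraph"
  where "curve_graph = \<lparr>pverts = UNIV,
    parcs = {(s, t). case (slope_rep s, slope_rep t) of ((p, q), (p', q')) \<Rightarrow> \<bar>p * q' - p' * q\<bar> = 2}\<rparr>"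

lemma wf_digraph_curve_graph: "wf_digraph (with_proj curve_graph)"
  by unfold_locales (auto simp: curve_graph_def)

text \<open>Graph distance: all arcs have weight 1, and the infimum over no walks is \<open>\<infinity>\<close>.\<close>

definition slope_dist :: "slope \<Rightarrow> slope \<Rightarrow> ereal"
  where "slope_dist = wf_digraph.\<mu> (with_proj curve_graph) (\<lambda>_. 1)"

definition slope_class :: "int \<Rightarrow> int \<Rightarrow> slope set"
  where "slope_class j k =
    {s. case slope_rep s of (p, q) \<Rightarrow> p mod 2 = j mod 2 \<and> q mod 2 = k mod 2}"

definition matrix_slope :: "int^2^2 \<Rightarrow> slope \<Rightarrow> slope"
  where "matrix_slope A s = (case slope_rep s of (p, q) \<Rightarrow>
    slope (A$1$1 * p + A$1$2 * q) (A$2$1 * p + A$2$2 * q))"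

definition diffeo_slope :: "(real \<Rightarrow> complex \<times> complex) \<Rightarrow> (real \<Rightarrow> complex \<times> complex)
    \<Rightarrow> (complex \<times> complex \<Rightarrow> complex \<times> complex) \<Rightarrow> slope \<Rightarrow> slope"
  where "diffeo_slope lam mu f = matrix_slope (homology_matrix lam mu f)"

definition min_displacement :: "(real \<Rightarrow> complex \<times> complex) \<Rightarrow> (real \<Rightarrow> complex \<times> complex)
    \<Rightarrow> (complex \<times> complex \<Rightarrow> complex \<times> complex) \<Rightarrow> int \<Rightarrow> int \<Rightarrow> ereal"
  where "min_displacement lam mu f j k =
    (INF v\<in>slope_class j k. slope_dist v (diffeo_slope lam mu f v))"


section \<open>The function \<open>N\<close>\<close>

fun cfrac_value :: "int list \<Rightarrow> rat"
  where
    "cfrac_value [] = 0"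
  | "cfrac_value [a] = of_int a"
  | "cfrac_value (a # a' # as) = of_int a + 1 / cfrac_value (a' # as)"

definition is_cfrac :: "rat \<Rightarrow> int list \<Rightarrow> bool"
  where "is_cfrac r as \<longleftrightarrow>
    as \<noteq> [] \<and> as ! 0 \<ge> 0 \<and> (\<forall>i. 0 < i \<and> i < length as - 1 \<longrightarrow> as ! i > 0) \<and> last as > 1 \<and>
    cfrac_value as = r"

fun cfrac_b :: "int list \<Rightarrow> nat \<Rightarrow> int"
  where
    "cfrac_b as 0 = as ! 0"
  | "cfrac_b as (Suc i) =
      (if cfrac_b as i = as ! i \<and> even (\<Sum>j\<in>{..i}. cfrac_b as j) then 0 else as ! Suc i)"

text \<open>Only meaningful for coprime \<open>p\<close> and \<open>q\<close>.\<close>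

definition N :: "int \<Rightarrow> int \<Rightarrow> ereal"
  where "N p q =
    (if odd p then \<infinity>
     else if p = 0 then 0
     else let as = (THE as. is_cfrac (of_int \<bar>p\<bar> / of_int \<bar>q\<bar>) as)
          in ereal ((1 / 2) * real_of_int (\<Sum>i<length as. cfrac_b as i)))"

end

theory Submission
  imports Defs
begin

text \<open>
  A diffeomorphism acts on homology by an invertible integral matrix, so only the action of
  \<open>GL(2, \<int>)\<close> on slopes matters. Every vertex of \<open>T\<^bsub>0/1\<^esub>\<close> except \<open>0/1\<close> has exactly one neighbour
  whose numerator has smaller absolute value, so \<open>T\<^bsub>0/1\<^esub>\<close> is a tree and its distance satisfies the
  four point condition. For an isometry \<open>f\<close> of such a space \<open>d(x, f\<^sup>2 x) - d(x, f x)\<close> is a lower bound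
  for all displacements \<open>d(y, f y)\<close>, and it is attained on the geodesic from \<open>x\<close> to \<open>f x\<close> unless
  \<open>f\<^sup>2\<close> fixes a vertex that \<open>f\<close> moves. The latter forces \<open>c (a + d) = 0\<close>, and then \<open>f\<^sup>2\<close> fixes
  \<open>0/1\<close> and the parity of \<open>d(0/1, f(0/1))\<close> decides between the displacements 0 and 1.

  The distance from \<open>0/1\<close> to \<open>p/q\<close> does not change when \<open>q\<close> is replaced by \<open>q + k p\<close>, and drops by one
  when \<open>p > q > 0\<close> is replaced by \<open>p - 2 q\<close>. Run along the Euclidean algorithm, these two rules
  compute \<open>N(p, q)\<close>. The other two components are carried to \<open>T\<^bsub>0/1\<^esub>\<close> by elements of
  \<open>GL(2, \<int>)\<close>.
\<close>

section \<open>The matrix of a diffeomorphism\<close>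

text \<open>In the basis \<open>x\<close>, \<open>y\<close> both \<open>F\<close> and its right
  inverse \<open>F'\<close> are given by integral matrices. Their product is the identity matrix, so
  the two determinants are integers with product 1.\<close>

lemma homology_iso_matrix_det:
  fixes G (structure) and a b c d :: int
  assumes G: "comm_group G" and x: "x \<in> carrier G" and y: "y \<in> carrier G"
    and basis: "(\<lambda>(m, n). x [^] (m::int) \<otimes> y [^] (n::int)) \<in> iso (integer_group \<times>\<times> integer_group) G"
    and F: "F \<in> hom G G" and F': "F' \<in> hom G G"
    and inv: "\<And>z. z \<in> carrier G \<Longrightarrow> F (F' z) = z"
    and Fx: "F x = x [^] a \<otimes> y [^] b" and Fy: "F y = x [^] c \<otimes> y [^] d"
  shows "\<bar>a * d - b * c\<bar> = 1"
proof -
  interpret comm_group G by fact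
  interpret F: group_hom G G F
    using F by unfold_locales
  let ?L = "\<lambda>(m::int) (n::int). x [^] m \<otimes> y [^] n"
  have bij: "bij_betw (\<lambda>(m, n). ?L m n) UNIV (carrier G)"
    using basis by (simp add: iso_def DirProd_def integer_group_def)
  have surj: "\<exists>m n. z = ?L m n" if "z \<in> carrier G" for z
    using bij that unfolding bij_betw_def by (metis (no_types, lifting) case_prod_unfold imageE)
  have inj: "m = m' \<and> n = n'" if "?L m n = ?L m' n'" for m n m' n'
    using bij that unfolding bij_betw_def inj_on_def by fastforce
  have F_L: "F (?L m n) = ?L (a * m + c * n) (b * m + d * n)" for m n
  proof -
    have "F (?L m n) = F x [^] m \<otimes> F y [^] n"
      using x y by (simp add: F.hom_mult F.hom_int_pow)
    also have "\<dots> = (x [^] (a * m) \<otimes> y [^] (b * m)) \<otimes> (x [^] (c * n) \<otimes> y [^] (d * n))"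
      using x y by (simp add: Fx Fy int_pow_distrib int_pow_pow)
    also have "\<dots> = (x [^] (a * m) \<otimes> x [^] (c * n)) \<otimes> (y [^] (b * m) \<otimes> y [^] (d * n))"
      using x y by (simp add: m_ac)
    finally show ?thesis
      using x y by (simp add: int_pow_mult)
  qed
  have F'_in: "F' z \<in> carrier G" if "z \<in> carrier G" for z
    using F' that by (auto simp: hom_def)
  obtain a' b' where a': "F' x = ?L a' b'" using surj F'_in x by blast
  obtain c' d' where c': "F' y = ?L c' d'" using surj F'_in y by blast
  have "?L (a * a' + c * b') (b * a' + d * b') = ?L 1 0"
    using inv[OF x] F_L x y by (simp add: a' int_pow_1)
  then have 1: "a * a' + c * b' = 1" "b * a' + d * b' = 0" using inj by blast+
  have "?L (a * c' + c * d') (b * c' + d * d') = ?L 0 1"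
    using inv[OF y] F_L x y by (simp add: c' int_pow_1)
  then have 2: "a * c' + c * d' = 0" "b * c' + d * d' = 1" using inj by blast+
  have "(a * d - b * c) * (a' * d' - b' * c')
      = (a * a' + c * b') * (b * c' + d * d') - (a * c' + c * d') * (b * a' + d * b')"
    by (simp add: algebra_simps)
  then have "(a * d - b * c) * (a' * d' - b' * c') = 1"
    using 1 2 by simp
  then show ?thesis
    using zmult_eq_1_iff by fastforce
qed

text \<open>As the curve is closed, both faces of its 1-simplex are the constant 0-simplex at
  \<open>\<gamma> 0\<close>, so the boundary vanishes.\<close>

lemma loop_class_in_carrier:
  assumes "simple_closed_curve_on torus \<gamma>"
  shows "loop_class \<gamma> \<in> carrier torus_H1"
proof -
  let ?s = "\<lambda>x\<in>standard_simplex 1. \<gamma> (x 1)"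
  let ?X = "subtopology (powertop_real UNIV) (standard_simplex 1)"
  have \<gamma>: "path \<gamma>" "\<gamma> 1 = \<gamma> 0" "\<gamma> ` {0..1} \<subseteq> torus"
    using assms by (auto simp: simple_closed_curve_on_def simple_path_def pathfinish_def
        pathstart_def path_image_def)
  have "continuous_map ?X (top_of_set {0..1}) (\<lambda>x. x 1)"
    by (auto simp: continuous_map_in_subtopology standard_simplex_def
        intro!: continuous_map_from_subtopology continuous_map_product_projection)
  moreover have "continuous_map (top_of_set {0..1}) (top_of_set torus) \<gamma>"
    using \<gamma> by (auto simp: path_def)
  ultimately have "continuous_map ?X (top_of_set torus) (\<gamma> \<circ> (\<lambda>x. x 1))"
    by (rule continuous_map_compose)
  then have "continuous_map ?X (top_of_set torus) ?s"
    by (rule continuous_map_eq) (auto simp: topspace_standard_simplex)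
  then have "singular_simplex 1 (top_of_set torus) ?s"
    by (simp add: singular_simplex_def)
  moreover have face: "singular_face 1 k ?s = (\<lambda>x\<in>standard_simplex 0. \<gamma> 0)" if "k = 0 \<or> k = 1" for k
  proof -
    have *: "simplical_face k x \<in> standard_simplex 1" if "x \<in> standard_simplex 0" for x :: "nat \<Rightarrow> real"
      using simplical_face_in_standard_simplex[of 1 k x] that \<open>k = 0 \<or> k = 1\<close> by auto
    have "\<gamma> (simplical_face k x 1) = \<gamma> 0" if "x \<in> standard_simplex 0" for x :: "nat \<Rightarrow> real"
      using that \<open>k = 0 \<or> k = 1\<close> \<gamma>(2) by (auto simp: simplical_face_def standard_simplex_0)
    then show ?thesis
      using * by (auto simp: singular_face_def restrict_def fun_eq_iff)
  qed
  have "{..Suc 0} = {0, 1}" by auto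
  then have "chain_boundary 1 (frag_of ?s) = 0"
    using face[of 0] face[of 1] by (simp add: chain_boundary_of)
  ultimately have "singular_relcycle 1 (top_of_set torus) {} (frag_of ?s)"
    by (simp add: singular_cycle singular_chain_of)
  then show ?thesis
    using carrier_relative_homology_group[of 1 "top_of_set torus" "{}"]
    by (auto simp: loop_class_def)
qed

lemma smooth_map_on_imp_continuous_on: "smooth_map_on S f \<Longrightarrow> continuous_on S f"
  unfolding smooth_map_on_def
  by (metis Ck.simps(1) continuous_on_cong continuous_on_subset)

lemma homology_matrix_det:
  assumes lam: "simple_closed_curve_on torus lam" and mu: "simple_closed_curve_on torus mu"
    and basis: "homology_basis lam mu" and f: "torus_diffeo f"
    and A: "homology_matrix lam mu f = vector [vector [a, c], vector [b, d]]"
  shows "\<bar>a * d - b * c\<bar> = 1"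
proof -
  let ?T = "top_of_set torus"
  let ?g = "inv_into torus f"
  let ?L = "lin_comb lam mu"
  interpret comm_group torus_H1
    by (rule abelian_homology_group)
  have carrier: "loop_class lam \<in> carrier torus_H1" "loop_class mu \<in> carrier torus_H1"
    using lam mu by (simp_all add: loop_class_in_carrier)
  have bij: "bij_betw f torus torus"
    and cont: "continuous_map ?T ?T f" "continuous_map ?T ?T ?g"
    using f bij_betw_inv_into[of f torus torus]
    by (auto simp: torus_diffeo_def bij_betw_def dest!: smooth_map_on_imp_continuous_on)
  have hom: "induced_H1 f \<in> hom torus_H1 torus_H1" "induced_H1 ?g \<in> hom torus_H1 torus_H1"
    by (simp_all add: hom_induced_hom)
  have inv: "induced_H1 f (induced_H1 ?g z) = z" if "z \<in> carrier torus_H1" for z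
  proof -
    have "induced_H1 f (induced_H1 ?g z) = induced_H1 (f \<circ> ?g) z"
      using cont by (intro hom_induced_compose') auto
    also have "\<dots> = z"
      using that cont bij bij_betw_inv_into_right[OF bij]
      by (intro hom_induced_id_gen continuous_map_compose[of ?T ?T _ ?T]) auto
    finally show ?thesis .
  qed
  have iso: "(\<lambda>(m, n). ?L m n) \<in> iso (integer_group \<times>\<times> integer_group) torus_H1"
    using basis by (simp add: homology_basis_def)
  then have L_bij: "bij_betw (\<lambda>(m, n). ?L m n) UNIV (carrier torus_H1)"
    by (simp add: iso_def DirProd_def integer_group_def)
  have surj: "\<exists>m n. z = ?L m n" if "z \<in> carrier torus_H1" for z
    using L_bij that unfolding bij_betw_def by (metis (no_types, lifting) case_prod_unfold imageE)
  have inj: "m = m' \<and> n = n'" if "?L m n = ?L m' n'" for m n m' n'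
    using L_bij that unfolding bij_betw_def inj_on_def by fastforce
  obtain m n where mn: "induced_H1 f (loop_class lam) = ?L m n"
    using surj hom carrier by (meson hom_carrier image_subset_iff hom_in_carrier)
  obtain m' n' where mn': "induced_H1 f (loop_class mu) = ?L m' n'"
    using surj hom carrier by (meson hom_carrier image_subset_iff hom_in_carrier)
  \<comment> \<open>The matrix is a definite description, so its entries can be read off only after
    existence and uniqueness of coordinates in the basis are known.\<close>
  have "homology_matrix lam mu f = vector [vector [m, m'], vector [n, n']]"
    unfolding homology_matrix_def
  proof (rule the_equality)
    fix B :: "int^2^2"
    assume "induced_H1 f (loop_class lam) = ?L (B$1$1) (B$2$1)
      \<and> induced_H1 f (loop_class mu) = ?L (B$1$2) (B$2$2)"
    then have "B$1$1 = m \<and> B$2$1 = n" "B$1$2 = m' \<and> B$2$2 = n'"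
      unfolding mn mn' using inj by metis+
    then show "B = vector [vector [m, m'], vector [n, n']]"
      by (simp add: vec_eq_iff forall_2)
  qed (simp add: mn mn')
  with A have "vector [vector [m, m'], vector [n, n']] = (vector [vector [a, c], vector [b, d]] :: int^2^2)"
    by simp
  then have "m = a" "m' = c" "n = b" "n' = d"
    by (auto simp: vec_eq_iff forall_2)
  then show ?thesis
    using homology_iso_matrix_det[OF comm_group_axioms carrier _ hom inv, of a b c d] iso mn mn'
    by (simp add: lin_comb_def)
qed

section \<open>Trees and displacements of their isometries\<close>

text \<open>Connectedness and absence of cycles are encoded by a unique neighbour of smaller rank.
  The rank need not be the distance from the root; for slopes it will be the absolute value of the
  numerator.\<close>

locale ranked_tree =
  fixes V :: "'a set" and adj :: "'a \<Rightarrow> 'a \<Rightarrow> bool" and rank :: "'a \<Rightarrow> nat" and root :: 'a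
  assumes root_in [simp]: "root \<in> V"
    and adj_closed: "u \<in> V \<Longrightarrow> adj u v \<Longrightarrow> v \<in> V"
    and adj_sym: "adj u v \<Longrightarrow> adj v u"
    and adj_rank: "u \<in> V \<Longrightarrow> adj u v \<Longrightarrow> rank u \<noteq> rank v"
    and root_rank: "v \<in> V \<Longrightarrow> rank root \<le> rank v"
    and ex1_parent: "v \<in> V \<Longrightarrow> v \<noteq> root \<Longrightarrow> \<exists>!u. adj v u \<and> rank u < rank v"
begin

definition parent :: "'a \<Rightarrow> 'a"
  where "parent v = (THE u. adj v u \<and> rank u < rank v)"

inductive_set anc :: "'a \<Rightarrow> 'a set" for v
  where
    anc_self [simp]: "v \<in> anc v"
  | anc_parent: "u \<in> anc v \<Longrightarrow> u \<noteq> root \<Longrightarrow> parent u \<in> anc v"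

text \<open>On \<open>V\<close> this is the Gromov product based at \<open>root\<close>, shifted by
  1 because vertices rather than edges are counted.\<close>

definition common :: "'a \<Rightarrow> 'a \<Rightarrow> nat"
  where "common u v = card (anc u \<inter> anc v)"

definition tree_dist :: "'a \<Rightarrow> 'a \<Rightarrow> nat"
  where "tree_dist u v = card (anc u) + card (anc v) - 2 * common u v"

lemma parent_props:
  assumes "v \<in> V" "v \<noteq> root"
  shows "adj v (parent v)" "rank (parent v) < rank v" "parent v \<in> V"
  using theI'[OF ex1_parent[OF assms]] adj_closed[OF assms(1)] by (auto simp: parent_def)

lemma parent_eqI:
  assumes "v \<in> V" "adj v u" "rank u < rank v"
  shows "v \<noteq> root" "parent v = u"
proof -
  show "v \<noteq> root"
    using root_rank[of u] adj_closed[of v u] assms by auto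
  then show "parent v = u"
    using ex1_parent[of v] assms by (auto simp: parent_def intro!: the1_equality)
qed

lemma anc_in: "u \<in> anc v \<Longrightarrow> v \<in> V \<Longrightarrow> u \<in> V"
  by (induction rule: anc.induct) (auto intro: parent_props)

lemma anc_trans: "u \<in> anc v \<Longrightarrow> v \<in> anc w \<Longrightarrow> u \<in> anc w"
  by (induction rule: anc.induct) (auto intro: anc_parent)

lemma anc_rank: "u \<in> anc v \<Longrightarrow> v \<in> V \<Longrightarrow> u = v \<or> rank u < rank v"
proof (induction rule: anc.induct)
  case (anc_parent u)
  then have "rank (parent u) < rank u" by (auto intro: parent_props anc_in)
  with anc_parent show ?case by auto
qed simp

lemma anc_antisym: "u \<in> anc v \<Longrightarrow> v \<in> anc u \<Longrightarrow> v \<in> V \<Longrightarrow> u = v"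
  using anc_rank anc_in by (metis order.asym)

lemma anc_root [simp]: "anc root = {root}"
proof -
  have "u = root" if "u \<in> anc root" for u
    using that by (induction rule: anc.induct) auto
  then show ?thesis by auto
qed

lemma anc_unfold:
  assumes "v \<in> V" "v \<noteq> root"
  shows "anc v = insert v (anc (parent v))" "v \<notin> anc (parent v)"
proof -
  have "u \<in> insert v (anc (parent v))" if "u \<in> anc v" for u
    using that by (induction rule: anc.induct) (auto intro: anc_parent)
  moreover have "anc (parent v) \<subseteq> anc v"
    using assms anc_trans[of _ "parent v" v] anc_parent[of v v] by auto
  ultimately show "anc v = insert v (anc (parent v))" by auto
  show "v \<notin> anc (parent v)"
    using anc_rank[of v "parent v"] parent_props[OF assms] by auto
qed

lemma parent_induct [consumes 1, case_names root step]:
  assumes "v \<in> V" "P root" "\<And>v. v \<in> V \<Longrightarrow> v \<noteq> root \<Longrightarrow> P (parent v) \<Longrightarrow> P v"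
  shows "P v"
  using assms(1)
proof (induction "rank v" arbitrary: v rule: less_induct)
  case less
  then show ?case using assms(2,3) parent_props by (cases "v = root") auto
qed

lemma finite_anc [simp]: "v \<in> V \<Longrightarrow> finite (anc v)"
  by (induction rule: parent_induct) (auto simp: anc_unfold)

lemma root_in_anc [simp]: "v \<in> V \<Longrightarrow> root \<in> anc v"
  by (induction rule: parent_induct) (auto simp: anc_unfold)

lemma card_anc_parent: "v \<in> V \<Longrightarrow> v \<noteq> root \<Longrightarrow> card (anc v) = Suc (card (anc (parent v)))"
  using anc_unfold[of v] parent_props[of v] by simp

lemma anc_linear: "v \<in> V \<Longrightarrow> u \<in> anc v \<Longrightarrow> w \<in> anc v \<Longrightarrow> u \<in> anc w \<or> w \<in> anc u"
  by (induction arbitrary: u w rule: parent_induct) (auto simp: anc_unfold dest: anc_trans)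

lemma common_sym: "common u v = common v u"
  by (simp add: common_def Int_commute)

lemma common_self [simp]: "common v v = card (anc v)"
  by (simp add: common_def)

lemma common_le: "u \<in> V \<Longrightarrow> common u v \<le> card (anc u)"
  by (auto simp: common_def intro: card_mono)

text \<open>Both \<open>anc x \<inter> anc z\<close> and \<open>anc z \<inter> anc y\<close> are
  segments of the chain \<open>anc z\<close> that start at the root, hence nested; the smaller one
  lies in \<open>anc x \<inter> anc y\<close>.\<close>

lemma common_ultra:
  assumes "x \<in> V" "y \<in> V" "z \<in> V"
  shows "min (common x z) (common z y) \<le> common x y"
proof -
  have "anc x \<inter> anc z \<subseteq> anc z \<inter> anc y \<or> anc z \<inter> anc y \<subseteq> anc x \<inter> anc z"
  proof (rule ccontr)
    assume "\<not> ?thesis"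
    then obtain a b where "a \<in> anc x \<inter> anc z" "a \<notin> anc y" "b \<in> anc z \<inter> anc y" "b \<notin> anc x"
      by blast
    then show False
      using anc_linear[OF \<open>z \<in> V\<close>, of a b] anc_trans by blast
  qed
  then have "anc x \<inter> anc z \<subseteq> anc x \<inter> anc y \<or> anc z \<inter> anc y \<subseteq> anc x \<inter> anc y"
    by blast
  then have "common x z \<le> common x y \<or> common z y \<le> common x y"
    using assms by (auto simp: common_def intro!: card_mono)
  then show ?thesis by auto
qed

lemma tree_dist_common: "u \<in> V \<Longrightarrow> v \<in> V \<Longrightarrow> tree_dist u v + 2 * common u v = card (anc u) + card (anc v)"
  using common_le[of u v] common_le[of v u] by (simp add: tree_dist_def common_sym)

lemma tree_dist_sym: "tree_dist u v = tree_dist v u"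
  by (simp add: tree_dist_def common_sym add.commute)

lemma tree_dist_self [simp]: "tree_dist v v = 0"
  by (simp add: tree_dist_def)

lemma tree_dist_eq_0:
  assumes "u \<in> V" "v \<in> V" "tree_dist u v = 0"
  shows "u = v"
proof -
  have "common u v = card (anc u)" "common u v = card (anc v)"
    using tree_dist_common[OF assms(1,2)] assms common_le[of u v] common_le[of v u]
    by (auto simp: common_sym)
  then have "anc u \<inter> anc v = anc u" "anc u \<inter> anc v = anc v"
    using assms card_subset_eq[of "anc u" "anc u \<inter> anc v"] card_subset_eq[of "anc v" "anc u \<inter> anc v"]
    by (auto simp: common_def)
  then show ?thesis
    using anc_antisym[of u v] assms anc_self by blast
qed

text \<open>Each of the three sums equals the total of the four cardinalities
  \<open>card (anc _)\<close> minus twice a sum of two values of \<open>common\<close>, so the claim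
  is an inequality between Gromov products, and \<open>common_ultra\<close> yields it.\<close>

lemma four_point:
  assumes "x \<in> V" "y \<in> V" "z \<in> V" "w \<in> V"
  shows "tree_dist x y + tree_dist z w
    \<le> max (tree_dist x z + tree_dist y w) (tree_dist x w + tree_dist y z)"
proof -
  have "min (common x z + common y w) (common x w + common y z) \<le> common x y + common z w"
    using common_ultra[of x y z] common_ultra[of x y w] common_ultra[of z w x] common_ultra[of z w y] assms
    by (simp add: common_sym[of z x] common_sym[of z y] common_sym[of w y] min_def split: if_splits)
  then show ?thesis
    using tree_dist_common[of x y] tree_dist_common[of z w] tree_dist_common[of x z]
      tree_dist_common[of y w] tree_dist_common[of x w] tree_dist_common[of y z] assms
    by linarith
qed

lemma triangle: "x \<in> V \<Longrightarrow> y \<in> V \<Longrightarrow> z \<in> V \<Longrightarrow> tree_dist x z \<le> tree_dist x y + tree_dist y z"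
  using four_point[of x z y y] by (simp add: tree_dist_sym)

lemma tree_dist_parity:
  assumes "x \<in> V" "y \<in> V" "z \<in> V"
  shows "even (tree_dist x y + tree_dist y z + tree_dist x z)"
proof -
  have "tree_dist x y + tree_dist y z + tree_dist x z
      + 2 * (common x y + common y z + common x z) = 2 * (card (anc x) + card (anc y) + card (anc z))"
    using tree_dist_common[of x y] tree_dist_common[of y z] tree_dist_common[of x z] assms by simp
  then have "even (tree_dist x y + tree_dist y z + tree_dist x z
      + 2 * (common x y + common y z + common x z))"
    by (metis dvd_triv_left)
  then show ?thesis by simp
qed

lemma tree_dist_parent:
  assumes "v \<in> V" "v \<noteq> root"
  shows "tree_dist v (parent v) = 1"
proof -
  have "anc v \<inter> anc (parent v) = anc (parent v)"
    using anc_unfold[OF assms] by auto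
  then show ?thesis
    using card_anc_parent[OF assms] by (simp add: tree_dist_def common_def)
qed

lemma tree_dist_adj:
  assumes "u \<in> V" "adj u v"
  shows "tree_dist u v = 1"
proof (cases "rank v < rank u")
  case True
  then show ?thesis
    using assms parent_eqI[of u v] tree_dist_parent[of u] by auto
next
  case False
  then have "rank u < rank v" using adj_rank[OF assms] by simp
  then show ?thesis
    using assms parent_eqI[of v u] tree_dist_parent[of v] adj_closed[of u v] adj_sym[of u v]
    by (auto simp: tree_dist_sym)
qed

text \<open>A geodesic climbs to parents until it meets an ancestor of \<open>y\<close>, and from
  there descends along the ancestors of \<open>y\<close>.\<close>

lemma ex_step:
  assumes "x \<in> V" "y \<in> V" "x \<noteq> y"
  obtains z where "z \<in> V" "adj x z" "tree_dist x y = Suc (tree_dist z y)"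
proof (cases "x \<in> anc y")
  case False
  then have "x \<noteq> root" using assms by auto
  note p = parent_props[OF assms(1) this] and u = anc_unfold[OF assms(1) this]
  have "common x y = common (parent x) y"
    using u False by (simp add: common_def)
  then have "tree_dist x y = Suc (tree_dist (parent x) y)"
    using tree_dist_common[of x y] tree_dist_common[of "parent x" y] p assms
      card_anc_parent[OF assms(1) \<open>x \<noteq> root\<close>] by linarith
  then show ?thesis using that p by blast
next
  case True
  then obtain z where z: "z \<in> anc y" "z \<noteq> root" "x = parent z"
    using assms(3) by (cases rule: anc.cases) auto
  then have "z \<in> V" using anc_in assms by blast
  note p = parent_props[OF this z(2)] and u = anc_unfold[OF this z(2)]
  have "anc z \<inter> anc y = insert z (anc x \<inter> anc y)" "z \<notin> anc x \<inter> anc y"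
    using u z by auto
  then have "common z y = Suc (common x y)"
    using assms by (simp add: common_def)
  then have "tree_dist x y = Suc (tree_dist z y)"
    using tree_dist_common[of x y] tree_dist_common[of z y] \<open>z \<in> V\<close> assms z
      card_anc_parent[OF \<open>z \<in> V\<close> z(2)] by simp
  then show ?thesis using that p adj_sym z \<open>z \<in> V\<close> by metis
qed

lemma geodesic:
  assumes "x \<in> V" "y \<in> V" "k \<le> tree_dist x y"
  shows "\<exists>z\<in>V. tree_dist x z = k \<and> tree_dist z y = tree_dist x y - k"
  using assms(3)
proof (induction k)
  case 0
  then show ?case using assms by (intro bexI[of _ x]) auto
next
  case (Suc k)
  then obtain z where z: "z \<in> V" "tree_dist x z = k" "tree_dist z y = tree_dist x y - k"
    by auto
  with Suc.prems have "z \<noteq> y" by auto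
  then obtain z' where z': "z' \<in> V" "adj z z'" "tree_dist z y = Suc (tree_dist z' y)"
    using ex_step z assms by blast
  then have "tree_dist z z' = 1" using tree_dist_adj z by blast
  then have "tree_dist x z' = Suc k"
    using triangle[of x z z'] triangle[of x z' y] z z' assms Suc.prems by simp
  then show ?case using z z' by auto
qed

lemma tree_dist_root: "v \<in> V \<Longrightarrow> tree_dist root v = card (anc v) - 1"
  by (simp add: tree_dist_def common_def)

section \<open>Isometries of a tree and their displacements\<close>

context
  fixes f :: "'a \<Rightarrow> 'a"
  assumes f_in: "\<And>v. v \<in> V \<Longrightarrow> f v \<in> V"
    and f_isom: "\<And>u v. u \<in> V \<Longrightarrow> v \<in> V \<Longrightarrow> tree_dist (f u) (f v) = tree_dist u v"
begin

text \<open>Apply the four point condition to the pairs \<open>x\<close>, \<open>f (f x)\<close> and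
  \<open>f x\<close>, \<open>y\<close>. By the triangle inequality through \<open>f y\<close>, both
  sums on the right are at most
  \<open>tree_dist x (f x) + tree_dist (f x) y + tree_dist y (f y)\<close>.\<close>

lemma displacement_ge:
  assumes "x \<in> V" "y \<in> V"
  shows "tree_dist x (f (f x)) \<le> tree_dist x (f x) + tree_dist y (f y)"
  using four_point[of x "f (f x)" "f x" y] triangle[of "f (f x)" "f y" y] triangle[of "f x" y "f y"]
    f_isom[of x y] f_isom[of x "f x"] f_isom[of "f x" y] assms
  by (simp add: f_in tree_dist_sym)

text \<open>The closed quadrilateral \<open>x\<close>, \<open>y\<close>, \<open>f y\<close>,
  \<open>f x\<close> has even perimeter, and its sides \<open>[x, y]\<close> and
  \<open>[f x, f y]\<close> have equal length.\<close>

lemma displacement_parity: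
  assumes "x \<in> V" "y \<in> V"
  shows "even (tree_dist x (f x)) \<longleftrightarrow> even (tree_dist y (f y))"
  using tree_dist_parity[of x y "f y"] tree_dist_parity[of x "f x" "f y"] f_isom[of x y] assms f_in
  by auto

text \<open>The last hypothesis bounds \<open>tree_dist x y\<close> by the Gromov product of
  \<open>x\<close> and \<open>f (f x)\<close> at \<open>f x\<close>. So \<open>f y\<close>, which
  lies on \<open>[f x, f (f x)]\<close>, is still on the part shared with
  \<open>[f x, x]\<close>.\<close>

lemma image_on_geodesic:
  assumes "x \<in> V" "y \<in> V" "tree_dist x y + tree_dist y (f x) = tree_dist x (f x)"
    and "2 * tree_dist x y + tree_dist x (f (f x)) \<le> 2 * tree_dist x (f x)"
  shows "tree_dist x (f y) = tree_dist y (f x)" "tree_dist (f y) (f x) = tree_dist x y"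
proof -
  show *: "tree_dist (f y) (f x) = tree_dist x y"
    using assms f_isom tree_dist_sym by metis
  have "tree_dist (f y) (f (f x)) = tree_dist y (f x)" "tree_dist (f x) (f (f x)) = tree_dist x (f x)"
    using assms f_isom f_in by blast+
  then show "tree_dist x (f y) = tree_dist y (f x)"
    using four_point[of x "f y" "f x" "f (f x)"] triangle[of x "f y" "f x"] assms * f_in
    by (auto simp: tree_dist_sym)
qed

text \<open>Both \<open>y\<close> and \<open>f y\<close> lie on \<open>[x, f x]\<close> in mirror
  positions, so their distance is the difference of \<open>tree_dist x y\<close> and
  \<open>tree_dist y (f x)\<close>; the maximum avoids subtraction on naturals.\<close>

lemma displacement_on_geodesic:
  assumes "x \<in> V" "y \<in> V" "tree_dist x y + tree_dist y (f x) = tree_dist x (f x)"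
    and "2 * tree_dist x y + tree_dist x (f (f x)) \<le> 2 * tree_dist x (f x)"
  shows "tree_dist y (f y) + tree_dist x (f x) \<le> 2 * max (tree_dist x y) (tree_dist y (f x))"
  using four_point[of y "f y" x "f x"] image_on_geodesic[OF assms] assms f_in
  by (auto simp: tree_dist_sym)

lemma displacement_elliptic:
  assumes "x \<in> V" "f (f x) = x"
  shows "\<exists>y\<in>V. tree_dist y (f y) = tree_dist x (f x) mod 2"
proof -
  let ?d = "tree_dist x (f x)"
  \<comment> \<open>Since \<open>f\<close> swaps \<open>x\<close> and \<open>f x\<close>, it
    reverses their geodesic. The witness is its midpoint, or an end of its middle edge.\<close>
  obtain y where y: "y \<in> V" "tree_dist x y = ?d div 2" "tree_dist y (f x) = ?d - ?d div 2"
    using geodesic[of x "f x" "?d div 2"] assms f_in by auto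
  have "tree_dist y (f y) \<le> ?d mod 2"
    using displacement_on_geodesic[of x y] y assms by (simp add: max_def split: if_splits) presburger
  then have "tree_dist y (f y) = ?d mod 2"
    using displacement_parity[OF assms(1) y(1)]
    by (cases "even (tree_dist x (f x))") (auto simp: odd_iff_mod_2_eq_one le_Suc_eq)
  then show ?thesis using y by blast
qed

lemma displacement_attained:
  assumes "x \<in> V" "\<And>y. y \<in> V \<Longrightarrow> f (f y) = y \<Longrightarrow> f y = y"
  shows "\<exists>y\<in>V. tree_dist y (f y) + tree_dist x (f x) = tree_dist x (f (f x))"
proof -
  let ?d = "tree_dist x (f x)" and ?e = "tree_dist x (f (f x))"
  have d: "tree_dist (f x) (f (f x)) = ?d"
    using f_isom f_in assms by blast
  have "even ?e" "?e \<le> 2 * ?d"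
    using tree_dist_parity[of x "f x" "f (f x)"] triangle[of x "f x" "f (f x)"] assms f_in d by auto
  then have "?e + 2 * (?d - ?e div 2) = 2 * ?d"
    by (auto elim!: evenE)
  then obtain m where m: "?e + 2 * m = 2 * ?d" ..
  \<comment> \<open>\<open>m\<close> is the length of the common initial part of \<open>[f x, x]\<close> and \<open>[f x, f (f x)]\<close>;
    hence \<open>f y\<close> again lies on \<open>[x, f x]\<close>, at distance \<open>m\<close> from \<open>f x\<close>.\<close>
  then obtain y where y: "y \<in> V" "tree_dist x y = m" "tree_dist y (f x) = ?d - m"
    using geodesic[of x "f x" m] assms f_in by auto
  have im: "tree_dist x (f y) = ?d - m" "tree_dist (f y) (f x) = m"
    using image_on_geodesic[of x y] y assms m by auto
  show ?thesis
  proof (cases "?e < ?d")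
    case True
    \<comment> \<open>Now the shared part is longer than half of \<open>[x, f x]\<close>, so the
      mirror argument also applies to \<open>f y\<close> and brings \<open>f (f y)\<close> back to
      \<open>y\<close>. Then \<open>y\<close> is fixed and \<open>m = ?d - m\<close>, which
      contradicts \<open>?e < ?d\<close>.\<close>
    have "tree_dist x (f (f y)) = m" "tree_dist (f (f y)) (f x) = ?d - m"
      using image_on_geodesic[of x "f y"] im y assms m True f_in by auto
    then have "tree_dist y (f (f y)) = 0"
      using four_point[of y "f (f y)" x "f x"] y assms m f_in by (auto simp: tree_dist_sym)
    then have "f (f y) = y" using y tree_dist_eq_0 f_in by metis
    then have "f y = y" using assms y by blast
    then show ?thesis using im y m True by simp
  next
    case False
    \<comment> \<open>Here \<open>m\<close> is at most half of \<open>?d\<close>, so the mirror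
      positions are at most \<open>?d - 2 * m\<close>, that is \<open>?e - ?d\<close>,
      apart.\<close>
    have "tree_dist y (f y) + ?d \<le> 2 * max m (?d - m)"
      using displacement_on_geodesic[of x y] y assms m by auto
    then have "tree_dist y (f y) + ?d \<le> ?e"
      using m False by (auto simp: max_def split: if_splits)
    then show ?thesis
      using displacement_ge[of x y] y assms by (intro bexI[of _ y]) auto
  qed
qed

end

end

section \<open>The action on slopes\<close>

lemma slope_uminus [simp]: "slope (- p) (- q) = slope p q"
  by (simp add: slope_def)

lemma slope_cases:
  obtains p q where "coprime p q" "s = slope p q"
proof -
  have "coprime (fst (slope_rep s)) (snd (slope_rep s))"
    by (cases s) (auto simp: quotient_of_coprime prod.case_eq_if)
  then show ?thesis
    using that slope_slope_rep[of s] by (metis case_prod_unfold)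
qed

lemma slope_eq_iff:
  assumes "coprime p q" "coprime p' q'"
  shows "slope p q = slope p' q' \<longleftrightarrow> (p = p' \<and> q = q') \<or> (p = - p' \<and> q = - q')"
  using slope_rep_slope[OF assms(1)] slope_rep_slope[OF assms(2)] slope_uminus[of p' q']
  by (metis Pair_inject minus_minus)

definition slope_adj :: "slope \<Rightarrow> slope \<Rightarrow> bool"
  where "slope_adj s t \<longleftrightarrow> (s, t) \<in> parcs curve_graph"

lemma slope_adj_slope:
  assumes "coprime p q" "coprime p' q'"
  shows "slope_adj (slope p q) (slope p' q') \<longleftrightarrow> \<bar>p * q' - p' * q\<bar> = 2"
  using slope_rep_slope[OF assms(1)] slope_rep_slope[OF assms(2)]
  by (auto simp: slope_adj_def curve_graph_def abs_minus_commute)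

lemma slope_adj_sym: "slope_adj s t \<Longrightarrow> slope_adj t s"
  by (auto simp: slope_adj_def curve_graph_def abs_minus_commute case_prod_unfold)

lemma slope_in_class_iff:
  assumes "coprime p q"
  shows "slope p q \<in> slope_class j k \<longleftrightarrow> p mod 2 = j mod 2 \<and> q mod 2 = k mod 2"
proof -
  have "(- x) mod 2 = x mod 2" for x :: int by presburger
  then show ?thesis
    using slope_rep_slope[OF assms] by (auto simp: slope_class_def)
qed

text \<open>Modulo 2 the representatives are nonzero vectors over the field of two elements with
  vanishing determinant, hence equal.\<close>

lemma slope_adj_class:
  assumes "slope_adj s t" "s \<in> slope_class j k"
  shows "t \<in> slope_class j k"
proof -
  obtain p q where s: "coprime p q" "s = slope p q" by (rule slope_cases)
  obtain p' q' where t: "coprime p' q'" "t = slope p' q'" by (rule slope_cases)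
  have "\<bar>p * q' - p' * q\<bar> = 2"
    using assms s t slope_adj_slope by simp
  then have "even (p * q' - p' * q)"
    by (metis dvd_refl dvd_abs_iff)
  moreover have "\<not> (even p \<and> even q)" "\<not> (even p' \<and> even q')"
    using s t by (metis coprime_common_divisor odd_one)+
  ultimately have "even p = even p'" "even q = even q'"
    by auto
  then have "p mod 2 = p' mod 2" "q mod 2 = q' mod 2"
    by presburger+
  then show ?thesis
    using assms s t by (simp add: slope_in_class_iff)
qed

text \<open>The arguments list the matrix row by row, which gives the order \<open>a c b d\<close>.
  Fixing integers instead of a matrix eases composition and conjugation.\<close>

definition mobius :: "int \<Rightarrow> int \<Rightarrow> int \<Rightarrow> int \<Rightarrow> slope \<Rightarrow> slope"
  where "mobius a c b d s = (case slope_rep s of (p, q) \<Rightarrow> slope (a * p + c * q) (b * p + d * q))"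

lemma mobius_slope:
  assumes "coprime p q"
  shows "mobius a c b d (slope p q) = slope (a * p + c * q) (b * p + d * q)"
  using slope_rep_slope[OF assms]
proof
  assume "slope_rep (slope p q) = (- p, - q)"
  moreover have "a * (- p) + c * (- q) = - (a * p + c * q)" "b * (- p) + d * (- q) = - (b * p + d * q)"
    by simp_all
  ultimately show ?thesis
    unfolding mobius_def by (simp only: case_prod_conv slope_uminus)
qed (simp add: mobius_def)

lemma coprime_mobius:
  fixes a b c d p q :: int
  assumes "\<bar>a * d - b * c\<bar> = 1" "coprime p q"
  shows "coprime (a * p + c * q) (b * p + d * q)"
proof (rule coprimeI)
  fix k assume k: "k dvd a * p + c * q" "k dvd b * p + d * q"
  have "k dvd d * (a * p + c * q) - c * (b * p + d * q)" "k dvd a * (b * p + d * q) - b * (a * p + c * q)"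
    using k by (meson dvd_diff dvd_mult)+
  then have "k dvd (a * d - b * c) * p" "k dvd (a * d - b * c) * q"
    by (simp_all add: algebra_simps)
  moreover have "a * d - b * c = 1 \<or> a * d - b * c = - 1"
    using assms by linarith
  ultimately have "k dvd p" "k dvd q" by auto
  then show "is_unit k" using assms coprime_common_divisor by blast
qed

lemma mobius_mobius:
  assumes "\<bar>a' * d' - b' * c'\<bar> = 1"
  shows "mobius a c b d (mobius a' c' b' d' s)
    = mobius (a * a' + c * b') (a * c' + c * d') (b * a' + d * b') (b * c' + d * d') s"
proof -
  obtain p q where s: "coprime p q" "s = slope p q" by (rule slope_cases)
  then show ?thesis
    using coprime_mobius[OF assms s(1)] by (simp add: mobius_slope algebra_simps)
qed

lemma mobius_1 [simp]: "mobius 1 0 0 1 s = s"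
  using slope_slope_rep[of s] by (simp add: mobius_def)

lemma mobius_minus_1 [simp]: "mobius (-1) 0 0 (-1) s = s"
  using slope_slope_rep[of s] by (simp add: mobius_def)

text \<open>The adjugate times the matrix is the determinant times the identity, and -1 acts
  trivially on slopes.\<close>

lemma mobius_inverse:
  assumes "\<bar>a * d - b * c\<bar> = 1"
  shows "mobius d (- c) (- b) a (mobius a c b d s) = s"
proof -
  consider "a * d - b * c = 1" | "a * d - b * c = - 1"
    using assms by linarith
  then show ?thesis
  proof cases
    case 1
    then have "d * a + - c * b = 1" "d * c + - c * d = 0" "- b * a + a * b = 0" "- b * c + a * d = 1"
      by (simp_all add: algebra_simps)
    then show ?thesis unfolding mobius_mobius[OF assms] by (simp only: mobius_1)
  next
    case 2
    then have "d * a + - c * b = -1" "d * c + - c * d = 0" "- b * a + a * b = 0" "- b * c + a * d = -1"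
      by (simp_all add: algebra_simps)
    then show ?thesis unfolding mobius_mobius[OF assms] by (simp only: mobius_minus_1)
  qed
qed

lemma slope_adj_mobius:
  assumes "\<bar>a * d - b * c\<bar> = 1" "slope_adj s t"
  shows "slope_adj (mobius a c b d s) (mobius a c b d t)"
proof -
  obtain p q where s: "coprime p q" "s = slope p q" by (rule slope_cases)
  obtain p' q' where t: "coprime p' q'" "t = slope p' q'" by (rule slope_cases)
  have "(a * p + c * q) * (b * p' + d * q') - (a * p' + c * q') * (b * p + d * q)
      = (a * d - b * c) * (p * q' - p' * q)"
    by (simp add: algebra_simps)
  moreover have "\<bar>p * q' - p' * q\<bar> = 2"
    using assms s t slope_adj_slope by simp
  ultimately show ?thesis
    using s t assms coprime_mobius by (simp add: mobius_slope slope_adj_slope abs_mult)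
qed

section \<open>Walks and the graph distance\<close>

abbreviation slope_walk :: "slope \<Rightarrow> (slope \<times> slope) list \<Rightarrow> slope \<Rightarrow> bool"
  where "slope_walk \<equiv> pre_digraph.awalk (with_proj curve_graph)"

lemma slope_walk_Nil: "slope_walk s [] t \<longleftrightarrow> s = t"
  by (simp add: wf_digraph.awalk_Nil_iff[OF wf_digraph_curve_graph]) (simp add: curve_graph_def)

lemma slope_walk_Cons: "slope_walk s (e # p) t \<longleftrightarrow> s = fst e \<and> slope_adj s (snd e) \<and> slope_walk (snd e) p t"
  by (cases e) (auto simp: wf_digraph.awalk_Cons_iff[OF wf_digraph_curve_graph] slope_adj_def)

lemma slope_dist_walk: "slope_dist s t = (INF p\<in>{p. slope_walk s p t}. ereal (real (length p)))"
proof -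
  interpret wf_digraph "with_proj curve_graph"
    by (rule wf_digraph_curve_graph)
  have "awalk_cost (\<lambda>_. 1) p = real (length p)" for p
    by (induction p) simp_all
  then show ?thesis
    by (simp add: slope_dist_def \<mu>_def)
qed

lemma slope_walk_class:
  "slope_walk s p t \<Longrightarrow> s \<in> slope_class j k \<Longrightarrow> t \<in> slope_class j k"
  by (induction p arbitrary: s) (auto simp: slope_walk_Nil slope_walk_Cons dest: slope_adj_class)

lemma slope_dist_infinity:
  assumes "s \<in> slope_class j k" "t \<notin> slope_class j k"
  shows "slope_dist s t = \<infinity>"
proof -
  have "{p. slope_walk s p t} = {}"
    using assms slope_walk_class by blast
  then show ?thesis by (simp add: slope_dist_walk top_ereal_def)
qed

lemma slope_dist_map_le:
  assumes "\<And>s t. slope_adj s t \<Longrightarrow> slope_adj (g s) (g t)"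
  shows "slope_dist (g s) (g t) \<le> slope_dist s t"
proof -
  have "slope_walk (g s) (map (map_prod g g) p) (g t)" if "slope_walk s p t" for p
    using that by (induction p arbitrary: s) (auto simp: slope_walk_Nil slope_walk_Cons assms)
  then show ?thesis
    unfolding slope_dist_walk
    by (intro INF_greatest) (metis (no_types, lifting) INF_lower length_map mem_Collect_eq)
qed

lemma slope_dist_mobius:
  assumes "\<bar>a * d - b * c\<bar> = 1"
  shows "slope_dist (mobius a c b d s) (mobius a c b d t) = slope_dist s t"
proof (rule antisym)
  show "slope_dist (mobius a c b d s) (mobius a c b d t) \<le> slope_dist s t"
    using assms by (intro slope_dist_map_le slope_adj_mobius)
  have "\<bar>d * a - (- b) * (- c)\<bar> = 1"
    using assms by (simp add: mult.commute)
  then have "slope_dist (mobius d (- c) (- b) a s') (mobius d (- c) (- b) a t') \<le> slope_dist s' t'" for s' t'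
    by (intro slope_dist_map_le slope_adj_mobius)
  from this[of "mobius a c b d s" "mobius a c b d t"]
  show "slope_dist s t \<le> slope_dist (mobius a c b d s) (mobius a c b d t)"
    unfolding mobius_inverse[OF assms] .
qed

section \<open>The component of 0/1\<close>

lemma abs_prod_eq_2_not_both_even:
  fixes a b :: int
  assumes "\<bar>a * b\<bar> = 2" "even a" "even b"
  shows False
proof -
  have "2 * 2 dvd a * b" using assms by (intro mult_dvd_mono)
  then have "4 dvd \<bar>a * b\<bar>" by simp
  then show False unfolding assms by simp
qed

lemma slope_in_01_iff: "coprime p q \<Longrightarrow> slope p q \<in> slope_class 0 1 \<longleftrightarrow> even p \<and> odd q"
  by (simp add: slope_in_class_iff even_iff_mod_2_eq_zero odd_iff_mod_2_eq_one)

lemma slope_01_cases: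
  assumes "s \<in> slope_class 0 1"
  obtains r q where "coprime (2 * r) q" "odd q" "0 \<le> r" "s = slope (2 * r) q"
proof -
  obtain p q where s: "coprime p q" "s = slope p q" by (rule slope_cases)
  then have pq: "even p" "odd q" using assms slope_in_01_iff by auto
  then obtain r where r: "p = 2 * r" by blast
  show ?thesis
  proof (cases "0 \<le> r")
    case True
    then show ?thesis using that s pq r by blast
  next
    case False
    then show ?thesis using that[of "- r" "- q"] s pq r slope_uminus[of p q] by simp
  qed
qed

section \<open>Farey parents and the tree structure\<close>

definition numer :: "slope \<Rightarrow> nat"
  where "numer s = nat \<bar>fst (slope_rep s)\<bar>"

lemma numer_slope: "coprime p q \<Longrightarrow> numer (slope p q) = nat \<bar>p\<bar>"
  using slope_rep_slope[of p q] by (auto simp: numer_def)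

lemma ex_Farey_parent:
  fixes r q :: int
  assumes "coprime r q" "0 < r" "odd q"
  shows "\<exists>x y. \<bar>r * y - x * q\<bar> = 1 \<and> 0 \<le> x \<and> x < r \<and> odd y"
proof -
  obtain u v where uv: "u * r + v * q = 1"
    using bezout_int[of r q] assms by (auto simp: coprime_iff_gcd_eq_1)
  obtain x t where x: "x = - v - r * t" "0 \<le> x" "x < r"
    using assms minus_mult_div_eq_mod[of "- v" r] pos_mod_sign[of r "- v"] pos_mod_bound[of r "- v"] by metis
  define y where "y = u - q * t"
  have xy: "r * y - x * q = 1" using uv by (simp add: x(1) y_def algebra_simps)
  show ?thesis
  proof (cases "odd y")
    case True
    then show ?thesis using x xy by (intro exI[of _ x] exI[of _ y]) simp
  next
    case False
    \<comment> \<open>If \<open>y\<close> is even, the other Farey parent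
      \<open>(r - x, q - y)\<close> is used: its denominator is odd, and \<open>x \<noteq> 0\<close>
      keeps its numerator below \<open>r\<close>.\<close>
    have "x \<noteq> 0"
    proof
      assume "x = 0"
      then have "y dvd 1" using xy by (metis diff_zero dvd_triv_right mult_zero_left)
      then show False using False by (meson dvd_trans odd_one)
    qed
    moreover have "r * (q - y) - (r - x) * q = - (r * y - x * q)" by (simp add: algebra_simps)
    ultimately show ?thesis
      using x xy False assms by (intro exI[of _ "r - x"] exI[of _ "q - y"]) simp
  qed
qed

lemma coprime_Farey_neighbour:
  fixes r q x y :: int
  assumes "\<bar>r * y - x * q\<bar> = 1" "odd y"
  shows "coprime (2 * x) y"
proof (rule coprimeI)
  fix k assume k: "k dvd 2 * x" "k dvd y"
  have "coprime k 2" using assms k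
    by (metis coprime_right_2_iff_odd dvd_trans)
  then have "k dvd x" using k by (simp add: coprime_dvd_mult_right_iff)
  then have "k dvd \<bar>r * y - x * q\<bar>" using k by simp
  then show "is_unit k" using assms by simp
qed

text \<open>Two solutions differ by a multiple \<open>k\<close> of \<open>(r, q)\<close>. As
  \<open>y\<close>, \<open>y'\<close> and \<open>q\<close> are odd, \<open>k\<close> is even, while
  the bounds on \<open>x\<close> and \<open>x'\<close> give
  \<open>\<bar>k\<bar> < 2\<close>.\<close>

lemma Farey_parent_unique_aux:
  fixes r q :: int
  assumes r: "coprime r q" "0 < r" "odd q" and xy: "r * y - x * q = r * y' - x' * q"
    and "\<bar>x\<bar> < r" "\<bar>x'\<bar> < r" "odd y" "odd y'"
  shows "x = x'" "y = y'"
proof -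
  have eq: "r * (y - y') = (x - x') * q" using xy by (simp add: algebra_simps)
  then have "r dvd (x - x') * q" by (metis dvd_triv_left)
  then obtain k where k: "x - x' = r * k"
    using r by (auto simp: coprime_dvd_mult_left_iff elim: dvdE)
  have "y - y' = k * q" using eq r by (simp add: k)
  then have "even (k * q)" using assms by (metis even_diff odd_add dvd_diff_commute even_add diff_add_cancel)
  then have "even k" using r by simp
  have "\<bar>r * k\<bar> < r * 2" using assms k by (smt (verit))
  then have "\<bar>k\<bar> < 2" using r by (simp add: abs_mult)
  then have "k = 0" using \<open>even k\<close> by (auto elim!: evenE)
  then show "x = x'" "y = y'" using k \<open>y - y' = k * q\<close> by auto
qed

lemma Farey_parent_unique:
  fixes r q :: int
  assumes r: "coprime r q" "0 < r" "odd q"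
    and xy: "\<bar>r * y - x * q\<bar> = 1" "\<bar>x\<bar> < r" "odd y"
    and xy': "\<bar>r * y' - x' * q\<bar> = 1" "\<bar>x'\<bar> < r" "odd y'"
  shows "slope (2 * x) y = slope (2 * x') y'"
proof (cases "r * y - x * q = r * y' - x' * q")
  case True
  then show ?thesis using Farey_parent_unique_aux[OF r] assms by metis
next
  case False
  \<comment> \<open>The determinants are 1 and -1; negating one pair makes them equal without
    changing its slope.\<close>
  then have "r * y - x * q = r * (- y') - (- x') * q" using xy xy' by (simp; linarith)
  then have "x = - x'" "y = - y'"
    using Farey_parent_unique_aux[OF r, of y x "- y'" "- x'"] assms by simp_all
  then show ?thesis by (metis mult_minus_right slope_uminus)
qed

lemma slope_adj_double:
  assumes "coprime (2 * r) q" "coprime (2 * x) y"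
  shows "slope_adj (slope (2 * r) q) (slope (2 * x) y) \<longleftrightarrow> \<bar>r * y - x * q\<bar> = 1"
proof -
  have "2 * r * y - 2 * x * q = 2 * (r * y - x * q)" by (simp add: algebra_simps)
  then show ?thesis unfolding slope_adj_slope[OF assms] by (simp only: abs_mult) simp
qed

lemma slope_ex1_parent:
  assumes "v \<in> slope_class 0 1" "v \<noteq> slope 0 1"
  shows "\<exists>!u. slope_adj v u \<and> numer u < numer v"
proof -
  obtain r q where v: "coprime (2 * r) q" "odd q" "0 \<le> r" "v = slope (2 * r) q"
    by (rule slope_01_cases[OF assms(1)])
  have "r \<noteq> 0"
  proof
    assume "r = 0"
    then show False using v assms slope_uminus[of 0 1] by (auto simp: zdvd1_eq abs_if split: if_splits)
  qed
  with v have r: "coprime r q" "0 < r" by simp_all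
  have num: "numer v = nat (2 * r)" using v by (simp add: numer_slope)
  obtain x y where xy: "\<bar>r * y - x * q\<bar> = 1" "0 \<le> x" "x < r" "odd y"
    using ex_Farey_parent[OF r \<open>odd q\<close>] by blast
  note cop = coprime_Farey_neighbour[OF xy(1,4)]
  show ?thesis
  proof (rule ex1I)
    show "slope_adj v (slope (2 * x) y) \<and> numer (slope (2 * x) y) < numer v"
      using xy v cop r num by (simp add: slope_adj_double numer_slope)
    fix u assume u: "slope_adj v u \<and> numer u < numer v"
    then have "u \<in> slope_class 0 1" using slope_adj_class assms by blast
    then obtain x' y' where u': "coprime (2 * x') y'" "odd y'" "0 \<le> x'" "u = slope (2 * x') y'"
      by (rule slope_01_cases)
    then have "\<bar>r * y' - x' * q\<bar> = 1" "\<bar>x'\<bar> < r"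
      using u v num by (simp_all add: slope_adj_double numer_slope)
    then show "u = slope (2 * x) y"
      using Farey_parent_unique[OF r \<open>odd q\<close>, of y' x' y x] u' xy by simp
  qed
qed

interpretation T01: ranked_tree "slope_class 0 1" slope_adj numer "slope 0 1"
proof
  show root: "slope 0 1 \<in> slope_class 0 1" by (simp add: slope_in_01_iff)
  show "numer (slope 0 1) \<le> numer v" for v by (simp add: numer_slope)
  show "numer u \<noteq> numer v" if uv: "u \<in> slope_class 0 1" "slope_adj u v" for u v
  proof
    assume n: "numer u = numer v"
    obtain r q where u: "coprime (2 * r) q" "odd q" "0 \<le> r" "u = slope (2 * r) q"
      by (rule slope_01_cases[OF uv(1)])
    obtain x y where v: "coprime (2 * x) y" "odd y" "0 \<le> x" "v = slope (2 * x) y"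
      by (rule slope_01_cases[OF slope_adj_class[OF uv(2,1)]])
    have "\<bar>r * y - x * q\<bar> = 1" using uv(2) slope_adj_double u v by simp
    moreover have "r = x" using n u v by (simp add: numer_slope)
    \<comment> \<open>With equal numerators the determinant is a product of two even numbers, hence
      divisible by 4.\<close>
    ultimately have "\<bar>(2 * r) * (y - q)\<bar> = 2" by (simp add: algebra_simps abs_mult)
    then show False using abs_prod_eq_2_not_both_even[of "2 * r" "y - q"] u v by simp
  qed
qed (fact slope_ex1_parent | blast intro: slope_adj_class slope_adj_sym)+

abbreviation dist01 :: "slope \<Rightarrow> slope \<Rightarrow> nat"
  where "dist01 \<equiv> T01.tree_dist"

text \<open>Iterating \<open>ex_step\<close> produces a walk of length \<open>dist01 s t\<close>;
  the triangle inequality shows that no walk is shorter.\<close>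

lemma slope_dist_01:
  assumes "s \<in> slope_class 0 1" "t \<in> slope_class 0 1"
  shows "slope_dist s t = ereal (real (dist01 s t))"
proof (rule antisym)
  have "\<exists>p. slope_walk s p t \<and> length p = n" if "dist01 s t = n" for n
    using that assms(1)
  proof (induction n arbitrary: s)
    case 0
    then show ?case
      using T01.tree_dist_eq_0[of s t] assms by (simp add: slope_walk_Nil)
  next
    case (Suc n)
    then have "s \<noteq> t" by auto
    then obtain z where "z \<in> slope_class 0 1" "slope_adj s z" "dist01 s t = Suc (dist01 z t)"
      using T01.ex_step[of s t] Suc.prems assms by blast
    moreover then obtain p where "slope_walk z p t \<and> length p = n"
      using Suc by auto
    ultimately show ?case
      by (intro exI[of _ "(s, z) # p"]) (simp add: slope_walk_Cons)
  qed
  then obtain p where "slope_walk s p t" "length p = dist01 s t" by blast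
  then show "slope_dist s t \<le> ereal (real (dist01 s t))"
    unfolding slope_dist_walk by (metis (no_types, lifting) INF_lower mem_Collect_eq)
  have "dist01 s t \<le> length p" if "slope_walk s p t" for p
    using that assms(1)
  proof (induction p arbitrary: s)
    case (Cons e p)
    then have "slope_adj s (snd e)" "slope_walk (snd e) p t"
      by (auto simp: slope_walk_Cons)
    then show ?case
      using Cons T01.tree_dist_adj[of s "snd e"] T01.triangle[of s "snd e" t] slope_adj_class assms(2)
      by fastforce
  qed (simp add: slope_walk_Nil)
  then show "ereal (real (dist01 s t)) \<le> slope_dist s t"
    unfolding slope_dist_walk by (intro INF_greatest) simp
qed

lemma dist01_mobius:
  assumes "\<bar>a * d - b * c\<bar> = 1" "s \<in> slope_class 0 1" "t \<in> slope_class 0 1"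
    and "mobius a c b d s \<in> slope_class 0 1" "mobius a c b d t \<in> slope_class 0 1"
  shows "dist01 (mobius a c b d s) (mobius a c b d t) = dist01 s t"
  using slope_dist_mobius[OF assms(1), of s t] assms by (simp add: slope_dist_01)

lemma mobius_in_01:
  assumes "\<bar>a * d - b * c\<bar> = 1" "even c" "odd d" "s \<in> slope_class 0 1"
  shows "mobius a c b d s \<in> slope_class 0 1"
proof -
  obtain r q where s: "coprime (2 * r) q" "odd q" "0 \<le> r" "s = slope (2 * r) q"
    by (rule slope_01_cases[OF assms(4)])
  then show ?thesis
    using assms coprime_mobius[OF assms(1) s(1)] by (simp add: mobius_slope slope_in_01_iff)
qed

section \<open>The distance from 0/1 under the steps of the Euclidean algorithm\<close>

definition depth :: "int \<Rightarrow> int \<Rightarrow> nat"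
  where "depth p q = dist01 (slope 0 1) (slope p q)"

lemma depth_0: "depth 0 1 = 0"
  by (simp add: depth_def)

text \<open>The matrix with rows \<open>(1, 0)\<close> and \<open>(k, 1)\<close> fixes 0/1 and maps
  \<open>p/q\<close> to \<open>p/(q + k p)\<close>.\<close>

lemma depth_shift:
  assumes "coprime p q" "even p"
  shows "depth p (q + k * p) = depth p q"
proof -
  have "odd q" using assms by (metis coprime_common_divisor odd_one)
  then show ?thesis
    using dist01_mobius[of 1 1 k 0 "slope 0 1" "slope p q"] mobius_in_01[of 1 1 k 0 "slope 0 1"]
      mobius_in_01[of 1 1 k 0 "slope p q"] assms
    by (simp add: depth_def mobius_slope slope_in_01_iff add.commute)
qed

lemma depth_uminus:
  assumes "coprime p q" "even p"
  shows "depth (- p) q = depth p q"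
proof -
  have "odd q" using assms by (metis coprime_common_divisor odd_one)
  then show ?thesis
    using dist01_mobius[of "-1" 1 0 0 "slope 0 1" "slope p q"] mobius_in_01[of "-1" 1 0 0 "slope 0 1"]
      mobius_in_01[of "-1" 1 0 0 "slope p q"] assms
    by (simp add: depth_def mobius_slope slope_in_01_iff)
qed

text \<open>The vertex \<open>2/1\<close> separates \<open>0/1\<close> from all \<open>p/q > 1\<close>.\<close>

lemma slope_2_1_anc:
  assumes "coprime (2 * r) q" "odd q" "0 < q" "q < 2 * r"
  shows "slope 2 1 \<in> T01.anc (slope (2 * r) q)"
  using assms
proof (induction "nat r" arbitrary: r q rule: less_induct)
  case less
  show ?case
  proof (cases "r = 1")
    case True
    then have "q = 1" using less.prems by (cases "q = 2") auto
    then show ?thesis using True by simp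
  next
    case False
    then have r: "coprime r q" "1 < r" using less.prems by auto
    obtain x y where xy: "\<bar>r * y - x * q\<bar> = 1" "0 \<le> x" "x < r" "odd y"
      using ex_Farey_parent[of r q] r less.prems by auto
    \<comment> \<open>To apply the induction hypothesis to the parent \<open>2x/y\<close>, it must
      again satisfy \<open>0 < y < 2 * x\<close>.\<close>
    have y: "0 < y"
    proof (rule ccontr)
      assume "\<not> 0 < y"
      with \<open>odd y\<close> have "y \<le> - 1" by (cases "y = 0") auto
      then have "r * y \<le> r * (- 1)" using r by (intro mult_left_mono) auto
      moreover have "0 \<le> x * q" using xy less.prems by simp
      ultimately show False using xy r by linarith
    qed
    have yx: "y < 2 * x"
    proof (rule ccontr)
      assume "\<not> y < 2 * x"
      \<comment> \<open>Multiplying the two integral gaps makes \<open>r * y - x * q\<close> too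
        large, unless \<open>x = 0\<close> and \<open>q = 1\<close>; then
        \<open>\<bar>r * y\<bar> = 1\<close> contradicts \<open>1 < r\<close>.\<close>
      with \<open>odd y\<close> have "2 * x + 1 \<le> y" by (cases "y = 2 * x") auto
      moreover have "q + 1 \<le> 2 * r" using less.prems by simp
      ultimately have "(q + 1) * (2 * x + 1) \<le> (2 * r) * y"
        using less.prems xy by (intro mult_mono) auto
      then have "q + 2 * x + 1 \<le> 2 * (r * y - x * q)" by (simp add: algebra_simps)
      moreover have "r * y - x * q \<le> 1" using xy(1) by (metis abs_ge_self)
      then have "2 * (r * y - x * q) \<le> 2 * 1" by (intro mult_left_mono) simp_all
      ultimately have "q + 2 * x + 1 \<le> 2" by (rule order_trans[THEN order_trans]) simp
      then have "x = 0" "q = 1" using xy less.prems by linarith+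
      then have "\<bar>r * y\<bar> = 1" using xy by simp
      then show False using r y by (auto simp: zmult_eq_1_iff abs_mult)
    qed
    note cop = coprime_Farey_neighbour[OF xy(1,4)]
    have "T01.parent (slope (2 * r) q) = slope (2 * x) y" "slope (2 * r) q \<noteq> slope 0 1"
      using T01.parent_eqI[of "slope (2 * r) q" "slope (2 * x) y"] cop less.prems xy r
      by (auto simp: slope_in_01_iff slope_adj_double numer_slope)
    then have "slope (2 * x) y \<in> T01.anc (slope (2 * r) q)"
      using T01.anc_parent[OF T01.anc_self] by metis
    moreover have "slope 2 1 \<in> T01.anc (slope (2 * x) y)"
      using less.hyps[of x y] cop xy y yx by simp
    ultimately show ?thesis using T01.anc_trans by blast
  qed
qed

lemma dist01_root_anc:
  assumes "v \<in> slope_class 0 1" "u \<in> T01.anc v"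
  shows "dist01 (slope 0 1) v = dist01 (slope 0 1) u + dist01 u v"
proof -
  have u: "u \<in> slope_class 0 1" using assms T01.anc_in by blast
  have "T01.anc u \<subseteq> T01.anc v" using assms T01.anc_trans by blast
  then have "T01.common u v = card (T01.anc u)"
    by (simp add: T01.common_def Int_absorb2)
  moreover have "card (T01.anc u) > 0"
    using T01.finite_anc[OF u] T01.anc_self by (metis card_gt_0_iff empty_iff)
  moreover have "T01.common u v \<le> card (T01.anc v)"
    using T01.common_le[OF assms(1)] T01.common_sym by metis
  ultimately show ?thesis
    using T01.tree_dist_common[OF u assms(1)] T01.tree_dist_root[OF u] T01.tree_dist_root[OF assms(1)]
    by simp
qed

text \<open>The geodesic from 0/1 to \<open>p/q\<close> passes through 2/1, which is adjacent to
  0/1. The matrix with rows \<open>(1, -2)\<close> and \<open>(0, 1)\<close> moves 2/1 to 0/1 and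
  \<open>p/q\<close> to \<open>(p - 2q)/q\<close>.\<close>

lemma depth_step:
  assumes "coprime p q" "even p" "0 < q" "q < p"
  shows "depth p q = Suc (depth (p - 2 * q) q)"
proof -
  have q: "odd q" using assms by (metis coprime_common_divisor odd_one)
  obtain r where r: "p = 2 * r" using assms by blast
  let ?v = "slope p q"
  have v: "?v \<in> slope_class 0 1" using assms q by (simp add: slope_in_01_iff)
  have o: "slope 2 1 \<in> slope_class 0 1" by (simp add: slope_in_01_iff)
  have cop: "coprime (p - 2 * q) q"
    using coprime_mobius[of 1 1 0 "-2" p q] assms by simp
  have "dist01 (slope 0 1) (slope 2 1) = 1"
    by (rule T01.tree_dist_adj) (simp_all add: slope_adj_slope)
  moreover have "dist01 (slope 2 1) ?v = dist01 (slope 0 1) (slope (p - 2 * q) q)"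
    using dist01_mobius[of 1 1 0 "-2" "slope 2 1" ?v] v o assms cop q
    by (simp add: mobius_slope slope_in_01_iff)
  ultimately show ?thesis
    using dist01_root_anc[OF v] slope_2_1_anc[of r q] assms q r by (simp add: depth_def)
qed

section \<open>Continued fractions\<close>

lemma is_cfrac_single: "is_cfrac r [a] \<longleftrightarrow> r = of_int a \<and> a > 1"
  by (auto simp: is_cfrac_def)

lemma is_cfrac_Cons:
  "is_cfrac r (a # a' # as) \<longleftrightarrow>
    0 \<le> a \<and> 0 < a' \<and> r = of_int a + 1 / cfrac_value (a' # as) \<and> is_cfrac (cfrac_value (a' # as)) (a' # as)"
  (is "?L \<longleftrightarrow> ?R")
proof
  assume L: ?L
  then have pos: "\<And>i. 0 < i \<Longrightarrow> i < length (a' # as) \<Longrightarrow> (a # a' # as) ! i > 0"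
    and last: "last (a' # as) > 1"
    by (auto simp: is_cfrac_def)
  have "0 < a'"
    using pos[of 1] last by (cases as) auto
  moreover have "(a' # as) ! i > 0" if "0 < i" "i < length as" for i
    using pos[of "Suc i"] that by simp
  ultimately show ?R using L last by (auto simp: is_cfrac_def)
next
  assume R: ?R
  then have pos: "\<And>i. 0 < i \<Longrightarrow> i < length as \<Longrightarrow> (a' # as) ! i > 0" "0 < a'"
    by (auto simp: is_cfrac_def)
  have "(a # a' # as) ! i > 0" if "0 < i" "i < length (a' # as)" for i
    using pos(1)[of "i - 1"] pos(2) that by (cases "i = 1") (auto simp: nth_Cons' split: if_splits)
  then show ?L using R by (auto simp: is_cfrac_def)
qed

lemma is_cfrac_gt_1: "is_cfrac r as \<Longrightarrow> 0 < hd as \<Longrightarrow> 1 < r"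
proof (induction as arbitrary: r rule: cfrac_value.induct)
  case (3 a a' as)
  then have "1 < cfrac_value (a' # as)"
    by (auto simp: is_cfrac_Cons)
  then have "0 < 1 / cfrac_value (a' # as)" by simp
  moreover have "1 \<le> (of_int a :: rat)" using 3 by simp
  moreover have "r = of_int a + 1 / cfrac_value (a' # as)" using 3 by (simp add: is_cfrac_Cons)
  ultimately show ?case by linarith
qed (auto simp: is_cfrac_single, simp add: is_cfrac_def)

text \<open>A nonempty tail has positive entries and a last entry above 1, so its value exceeds 1
  and its reciprocal lies strictly between 0 and 1.\<close>

lemma is_cfrac_floor:
  assumes "is_cfrac r (a # as)"
  shows "\<lfloor>r\<rfloor> = a" "as = [] \<longleftrightarrow> r = of_int a"
proof -
  have "\<lfloor>r\<rfloor> = a \<and> (as = [] \<longleftrightarrow> r = of_int a)"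
  proof (cases as)
    case (Cons a' as')
    then have "1 < cfrac_value (a' # as')" and r: "r = of_int a + 1 / cfrac_value (a' # as')"
      using assms is_cfrac_gt_1[of "cfrac_value (a' # as')" "a' # as'"] by (auto simp: is_cfrac_Cons)
    then have "0 < 1 / cfrac_value (a' # as')" "1 / cfrac_value (a' # as') < 1" by simp_all
    then show ?thesis unfolding r using Cons by (simp add: floor_unique)
  qed (use assms in \<open>auto simp: is_cfrac_single\<close>)
  then show "\<lfloor>r\<rfloor> = a" "as = [] \<longleftrightarrow> r = of_int a" by auto
qed

lemma is_cfrac_unique: "is_cfrac r as \<Longrightarrow> is_cfrac r bs \<Longrightarrow> as = bs"
proof (induction as arbitrary: r bs rule: cfrac_value.induct)
  case 1
  then show ?case by (simp add: is_cfrac_def)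
next
  case (2 a)
  then obtain b bs' where "bs = b # bs'" by (cases bs) (auto simp: is_cfrac_def)
  then show ?case using 2 is_cfrac_floor by metis
next
  case (3 a a' as)
  then obtain b bs' where bs: "bs = b # bs'" by (cases bs) (auto simp: is_cfrac_def)
  then have b: "b = a" "bs' \<noteq> []" using 3 is_cfrac_floor by (metis list.distinct(1))+
  then obtain b' bs'' where bs': "bs' = b' # bs''" by (cases bs') auto
  have "is_cfrac (cfrac_value (a' # as)) (a' # as)" "is_cfrac (cfrac_value (b' # bs'')) (b' # bs'')"
    "1 / cfrac_value (a' # as) = 1 / cfrac_value (b' # bs'')"
    using 3 bs bs' b by (auto simp: is_cfrac_Cons)
  moreover from this have "cfrac_value (a' # as) = cfrac_value (b' # bs'')" by simp
  ultimately show ?case using 3 bs bs' b by metis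
qed

function cfrac_of :: "int \<Rightarrow> int \<Rightarrow> int list"
  where "cfrac_of p q = (if q \<le> 0 then [] else p div q # cfrac_of q (p mod q))"
  by auto
termination by (relation "Wellfounded.measure (\<lambda>(p, q). nat q)") auto

declare cfrac_of.simps [simp del]

lemma cfrac_of_Cons: "0 < q \<Longrightarrow> cfrac_of p q = p div q # cfrac_of q (p mod q)"
  by (subst cfrac_of.simps) simp

lemma cfrac_of_0: "cfrac_of p 0 = []"
  by (subst cfrac_of.simps) simp

text \<open>The proviso for \<open>q = 1\<close> excludes 0/1 and 1/1, whose Euclidean expansions
  end in 0 and 1. It persists along the algorithm because remainders are smaller than
  divisors.\<close>

lemma is_cfrac_cfrac_of:
  assumes "coprime p q" "0 \<le> p" "0 < q" "q = 1 \<Longrightarrow> 1 < p"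
  shows "is_cfrac (of_int p / of_int q) (cfrac_of p q)"
  using assms
proof (induction p q rule: cfrac_of.induct)
  case (1 p q)
  let ?s = "p mod q"
  show ?case
  proof (cases "?s = 0")
    case True
    then have "q dvd p" by (simp add: dvd_eq_mod_eq_0)
    then have "q = 1" using 1 by (metis coprime_absorb_right abs_of_pos zdvd1_eq)
    then show ?thesis using 1 by (simp add: cfrac_of_Cons cfrac_of_0 is_cfrac_single)
  next
    case False
    then have s: "0 < ?s" "?s < q" using 1 pos_mod_bound[of q p] by (simp_all add: order_less_le)
    have "coprime q ?s" using 1 by (simp add: coprime_commute)
    then have IH: "is_cfrac (of_int q / of_int ?s) (cfrac_of q ?s)"
      using 1 s by simp
    have "q div ?s > 0" using s by (simp add: pos_imp_zdiv_pos_iff)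
    moreover have "cfrac_value (cfrac_of q ?s) = of_int q / of_int ?s"
      using IH by (simp add: is_cfrac_def)
    moreover have "(of_int p :: rat) = of_int (p div q) * of_int q + of_int ?s"
      by (metis div_mult_mod_eq of_int_add of_int_mult)
    then have "(of_int p / of_int q :: rat) = of_int (p div q) + 1 / (of_int q / of_int ?s)"
      using 1 by (simp add: field_simps)
    ultimately show ?thesis
      using IH s 1 unfolding cfrac_of_Cons[OF \<open>0 < q\<close>, of p] cfrac_of_Cons[OF s(1), of q]
      by (simp add: is_cfrac_Cons pos_imp_zdiv_nonneg_iff)
  qed
qed

text \<open>
  The sum of the \<open>b\<^sub>i\<close> over the rest of the expansion, when its first entry is not skipped; the flag
  tells whether the sum of the preceding \<open>b\<^sub>i\<close> is even.
\<close>

fun skip_sum :: "bool \<Rightarrow> int list \<Rightarrow> int"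
  where
    "skip_sum e [] = 0"
  | "skip_sum e (a # as) = a + (if even a = e then skip_sum True (tl as) else skip_sum False as)"

lemma sum_cfrac_b_from:
  assumes pos: "\<And>j. 0 < j \<Longrightarrow> j < length as \<Longrightarrow> as ! j > 0"
    and "i < length as" "cfrac_b as i = as ! i"
  shows "(\<Sum>j = i..<length as. cfrac_b as j) = skip_sum (even (\<Sum>j<i. cfrac_b as j)) (drop i as)"
  using assms(2,3)
proof (induction "length as - i" arbitrary: i rule: less_induct)
  case less
  let ?b = "cfrac_b as" and ?n = "length as"
  let ?e = "even (\<Sum>j<i. ?b j)"
  have drop: "drop i as = as ! i # drop (Suc i) as"
    using less.prems by (simp add: Cons_nth_drop_Suc)
  have split: "(\<Sum>j = i..<?n. ?b j) = as ! i + (\<Sum>j = Suc i..<?n. ?b j)"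
    using less.prems by (simp add: sum.atLeast_Suc_lessThan)
  have parity: "even (\<Sum>j\<in>{..i}. ?b j) \<longleftrightarrow> even (as ! i) = ?e"
    using less.prems by (auto simp: lessThan_Suc_atMost[symmetric])
  show ?case
  proof (cases "even (as ! i) = ?e")
    case False
    then have next': "?b (Suc i) = as ! Suc i" using parity by simp
    have "(\<Sum>j = Suc i..<?n. ?b j) = skip_sum False (drop (Suc i) as)"
    proof (cases "Suc i < ?n")
      case True
      then show ?thesis
        using less.hyps[of "Suc i"] next' False parity less.prems by (simp add: lessThan_Suc_atMost)
    qed simp
    then show ?thesis using False split drop by simp
  next
    case True
    then have b1: "?b (Suc i) = 0" using parity less.prems by simp
    have "(\<Sum>j = Suc i..<?n. ?b j) = skip_sum True (drop (Suc (Suc i)) as)"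
    proof (cases "Suc i < ?n")
      case S: True
      \<comment> \<open>Positivity ensures that a skipped entry has \<open>b\<close> different from
        \<open>a\<close>, so the entry after it is never skipped.\<close>
      then have "as ! Suc i > 0" using pos by simp
      then have b2: "?b (Suc (Suc i)) = as ! Suc (Suc i)"
        using b1 by (simp del: cfrac_b.simps add: cfrac_b.simps(2)[of as "Suc i"])
      have ev: "even (\<Sum>j<Suc (Suc i). ?b j)"
        using True parity b1 by (simp add: lessThan_Suc_atMost del: cfrac_b.simps)
      have "(\<Sum>j = Suc i..<?n. ?b j) = (\<Sum>j = Suc (Suc i)..<?n. ?b j)"
        using S b1 by (simp add: sum.atLeast_Suc_lessThan del: cfrac_b.simps)
      also have "\<dots> = skip_sum True (drop (Suc (Suc i)) as)"
      proof (cases "Suc (Suc i) < ?n")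
        case True
        then show ?thesis
          using less.hyps[of "Suc (Suc i)"] b2 ev less.prems by (simp del: cfrac_b.simps)
      qed simp
      finally show ?thesis .
    qed simp
    then show ?thesis using True split drop by (simp add: drop_Suc tl_drop)
  qed
qed

lemma sum_cfrac_b:
  assumes "is_cfrac r as"
  shows "(\<Sum>j<length as. cfrac_b as j) = skip_sum True as"
proof -
  have "as ! j > 0" if "0 < j" "j < length as" for j
  proof (cases "j < length as - 1")
    case False
    then have "j = length as - 1" using that by linarith
    moreover have "as \<noteq> []" using that by auto
    ultimately have "as ! j = last as" by (simp add: last_conv_nth)
    then show ?thesis using assms by (auto simp: is_cfrac_def)
  qed (use assms that in \<open>auto simp: is_cfrac_def\<close>)
  then show ?thesis
    using sum_cfrac_b_from[of as 0] assms by (simp add: is_cfrac_def lessThan_atLeast0)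
qed

section \<open>Comparison of the distance from 0/1 with the expansion\<close>

lemma depth_add:
  assumes "coprime s q" "even s" "0 \<le> s" "0 < q"
  shows "depth (s + 2 * int k * q) q = k + depth s q"
proof (induction k)
  case (Suc k)
  let ?p = "s + 2 * int (Suc k) * q"
  have "coprime ?p q"
    using assms coprime_mobius[of 1 1 0 "2 * int (Suc k)" s q] by simp
  moreover have p: "?p = (s + 2 * int k * q) + 2 * q" by (simp add: algebra_simps)
  moreover have "0 \<le> 2 * int k * q" using assms by simp
  then have "q < ?p"
    unfolding p using assms by linarith
  ultimately have "depth ?p q = Suc (depth (?p - 2 * q) q)"
    using assms by (intro depth_step) simp_all
  then show ?case unfolding p add_diff_cancel_right' using Suc by simp
qed simp

text \<open>As slopes, \<open>p/(p - q)\<close> equals \<open>(-p)/(q - p)\<close>; a reflection and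
  a shift then lead to \<open>p/q\<close>.\<close>

lemma depth_swap:
  assumes "coprime p q" "even p"
  shows "depth p (p - q) = depth p q"
proof -
  have "depth p (p - q) = depth (- p) (q - p)"
    using slope_uminus[of p "p - q"] by (simp add: depth_def)
  also have "\<dots> = depth p (q - p)"
    using assms coprime_mobius[of 1 1 "-1" 0 p q] by (intro depth_uminus) simp_all
  also have "\<dots> = depth p q"
    using depth_shift[OF assms, of "-1"] by simp
  finally show ?thesis .
qed

lemma depth_mod:
  assumes "coprime s q" "even s"
  shows "depth s (q mod s) = depth s q"
proof -
  have "q mod s = q + (- (q div s)) * s"
    by (simp add: minus_div_mult_eq_mod[symmetric])
  then show ?thesis using depth_shift[OF assms, of "- (q div s)"] by simp
qed

text \<open>
  For \<open>p\<close> odd, the expansion of \<open>p/q\<close> is what follows the entry \<open>1\<close> in that of \<open>1 + q/p\<close>, and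
  \<open>(p + q)/p\<close> has the same depth as \<open>(p + q)/q\<close>.
\<close>

lemma skip_sum_cfrac_of:
  assumes "coprime p q" "0 \<le> p" "0 < q" "odd q"
  shows "(even p \<longrightarrow> skip_sum True (cfrac_of p q) = 2 * int (depth p q)) \<and>
    (odd p \<longrightarrow> skip_sum False (cfrac_of p q) = 2 * int (depth (p + q) q) - 1)"
  using assms
proof (induction "nat q" arbitrary: p q rule: less_induct)
  case less
  define a where "a = p div q"
  define s where "s = p mod q"
  have p: "p = a * q + s" and s: "0 \<le> s" "s < q"
    using less.prems by (simp_all add: a_def s_def)
  have a: "0 \<le> a" using less.prems by (simp add: a_def pos_imp_zdiv_nonneg_iff)
  have cf: "cfrac_of p q = a # cfrac_of q s"
    using less.prems by (simp add: cfrac_of_Cons a_def s_def)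
  have cop: "coprime s q" using less.prems by (simp add: s_def coprime_commute)
  have ps: "even p \<longleftrightarrow> (even a \<longleftrightarrow> even s)" using p less.prems by auto
  \<comment> \<open>Skipping the entry \<open>q div s\<close> amounts to replacing \<open>q\<close>
    by \<open>q mod s\<close>, which preserves the depth.\<close>
  have skip: "skip_sum True (tl (cfrac_of q s)) = 2 * int (depth s q)" if "even s"
  proof (cases "s = 0")
    case True
    then have "q = 1" using cop less.prems by simp
    then show ?thesis using True by (simp add: cfrac_of_0 depth_0)
  next
    case False
    then have "0 < s" using s by simp
    have "odd (q mod s)" using \<open>even s\<close> \<open>odd q\<close> by (metis dvd_mod_iff)
    then have "0 < q mod s" using \<open>0 < s\<close> by (metis even_zero order_le_less pos_mod_sign)
    have "coprime s (q mod s)" using cop False by (simp add: coprime_commute)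
    have "nat (q mod s) < nat q"
      using pos_mod_bound[OF \<open>0 < s\<close>, of q] s \<open>0 < s\<close> by linarith
    then have "skip_sum True (cfrac_of s (q mod s)) = 2 * int (depth s (q mod s))"
      using less.hyps[of "q mod s" s] \<open>even s\<close> \<open>coprime s (q mod s)\<close> \<open>0 < q mod s\<close> \<open>odd (q mod s)\<close> s
      by blast
    then show ?thesis using \<open>0 < s\<close> depth_mod[OF cop \<open>even s\<close>] by (simp add: cfrac_of_Cons)
  qed
  \<comment> \<open>For odd \<open>s\<close> the next entry is kept. The induction hypothesis for
    the pair \<open>q\<close>, \<open>s\<close> speaks of \<open>(q + s)/s\<close>, and
    \<open>depth_swap\<close> turns this into \<open>(s + q)/q\<close>.\<close>
  have keep: "skip_sum False (cfrac_of q s) = 2 * int (depth (s + q) q) - 1" if "odd s"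
  proof -
    have "0 < s" using s that by (metis even_zero order_le_less)
    have "coprime (q + s) s" "even (q + s)"
      using cop less.prems that coprime_mobius[of 1 1 0 1 q s] by (simp_all add: coprime_commute)
    then have "depth (s + q) q = depth (q + s) s"
      using depth_swap[of "q + s" s] by (simp add: add.commute)
    moreover have "coprime q s" "0 \<le> q" "nat s < nat q" using cop s less.prems by (simp_all add: coprime_commute)
    ultimately show ?thesis using less.hyps[of s q] \<open>0 < s\<close> that less.prems by simp
  qed
  have cop': "coprime (s + q) q" using cop coprime_mobius[of 1 1 0 1 s q] by simp
  obtain n where n: "a = int n" using a by (rule nonneg_int_cases)
  \<comment> \<open>Every two units of \<open>a\<close> give one unit of depth. Where parity
    requires it, an extra \<open>q\<close> makes the numerator even, and this accounts for the
    -1.\<close>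
  show ?case
  proof (cases "even s")
    case True
    note add = depth_add[OF cop True s(1) less.prems(3)]
    show ?thesis
    proof (cases "even n")
      case e: True
      then obtain k where k: "n = 2 * k" by blast
      then have "p = s + 2 * int k * q" using n p by simp
      then have "depth p q = k + depth s q" using add[of k] by metis
      then show ?thesis using True e ps cf skip n k by simp
    next
      case o: False
      then obtain k where k: "n = 2 * k + 1" by (elim oddE)
      then have "p + q = s + 2 * int (Suc k) * q" using n p by (simp add: algebra_simps)
      then have "depth (p + q) q = Suc k + depth s q" using add[of "Suc k"] by metis
      then show ?thesis using True o ps cf skip n k by simp
    qed
  next
    case False
    then have ev: "even (s + q)" "0 \<le> s + q" using less.prems s by simp_all
    note add = depth_add[OF cop' ev less.prems(3)]
    show ?thesis
    proof (cases "even n")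
      case e: True
      then obtain k where k: "n = 2 * k" by blast
      then have "p + q = (s + q) + 2 * int k * q" using n p by simp
      then have "depth (p + q) q = k + depth (s + q) q" using add[of k] by metis
      then show ?thesis using False e ps cf keep n k by simp
    next
      case o: False
      then obtain k where k: "n = 2 * k + 1" by (elim oddE)
      then have "p = (s + q) + 2 * int k * q" using n p by (simp add: algebra_simps)
      then have "depth p q = k + depth (s + q) q" using add[of k] by metis
      then show ?thesis using False o ps cf keep n k by simp
    qed
  qed
qed

lemma depth_abs:
  assumes "coprime p q" "even p"
  shows "depth \<bar>p\<bar> \<bar>q\<bar> = depth p q"
proof -
  have 1: "depth \<bar>p\<bar> q = depth p q"
    using depth_uminus[OF assms] by (simp add: abs_if)
  have "depth \<bar>p\<bar> (- q) = depth (- \<bar>p\<bar>) q"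
    using slope_uminus[of "\<bar>p\<bar>" "- q"] by (simp add: depth_def)
  also have "\<dots> = depth \<bar>p\<bar> q"
    using assms by (intro depth_uminus) simp_all
  finally show ?thesis using 1 by (simp add: abs_if[of q])
qed

lemma N_eq_depth:
  assumes "coprime p q" "even p" "odd q"
  shows "N p q = ereal (real (depth p q))"
proof (cases "p = 0")
  case True
  then have "\<bar>q\<bar> = 1" using assms by simp
  then have "depth p q = 0" using depth_abs[OF assms(1,2)] True by (simp add: depth_0)
  then show ?thesis using True by (simp add: N_def)
next
  case False
  have q: "0 < \<bar>q\<bar>" "odd \<bar>q\<bar>" using assms by auto
  have cop: "coprime \<bar>p\<bar> \<bar>q\<bar>" using assms by simp
  \<comment> \<open>Evenness excludes numerator 1, so the proviso of
    \<open>is_cfrac_cfrac_of\<close> holds.\<close>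
  have "\<bar>p\<bar> \<noteq> 1" using assms by (metis odd_one dvd_abs_iff)
  then have "1 < \<bar>p\<bar>" using False by linarith
  then have cf: "is_cfrac (of_int \<bar>p\<bar> / of_int \<bar>q\<bar>) (cfrac_of \<bar>p\<bar> \<bar>q\<bar>)"
    using is_cfrac_cfrac_of[OF cop] q by simp
  then have the: "(THE as. is_cfrac (of_int \<bar>p\<bar> / of_int \<bar>q\<bar>) as) = cfrac_of \<bar>p\<bar> \<bar>q\<bar>"
    using is_cfrac_unique by blast
  have "(\<Sum>i<length (cfrac_of \<bar>p\<bar> \<bar>q\<bar>). cfrac_b (cfrac_of \<bar>p\<bar> \<bar>q\<bar>) i) = 2 * int (depth p q)"
    using sum_cfrac_b[OF cf] skip_sum_cfrac_of[OF cop _ q] assms depth_abs[OF assms(1,2)] by simp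
  then show ?thesis
    unfolding N_def Let_def the using assms False by simp
qed

section \<open>Minimal displacements\<close>

lemma slope_eqI:
  assumes "coprime p q" "coprime p' q'" "p * q' = p' * q"
  shows "slope p q = slope p' q'"
proof -
  have "q = 0 \<longleftrightarrow> q' = 0"
    using assms by (metis coprime_0_right_iff mult_eq_0_iff not_is_unit_0)
  then show ?thesis using assms by (simp add: slope_def eq_rat)
qed

text \<open>Along an edge \<open>r * y - x * q\<close> is 1 or -1 with \<open>q\<close> and
  \<open>y\<close> odd, so the half numerators \<open>r\<close> and \<open>x\<close> have opposite
  parity.\<close>

lemma even_depth_iff:
  assumes "coprime (2 * r) q" "odd q"
  shows "even (depth (2 * r) q) \<longleftrightarrow> even r"
proof -
  have "even (dist01 (slope 0 1) v) \<longleftrightarrow> even r"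
    if "v \<in> slope_class 0 1" "coprime (2 * r) q" "v = slope (2 * r) q" for v r q
    using that
  proof (induction arbitrary: r q rule: T01.parent_induct)
    case root
    then have "r = 0" using slope_eq_iff[of 0 1 "2 * r" q] by auto
    then show ?case by simp
  next
    case (step v)
    note p = T01.parent_props[OF step.hyps]
    obtain x y where xy: "coprime (2 * x) y" "odd y" "0 \<le> x" "T01.parent v = slope (2 * x) y"
      by (rule slope_01_cases[OF p(3)])
    have "\<bar>r * y - x * q\<bar> = 1" using p(1) step.prems xy slope_adj_double by simp
    then have "odd (r * y - x * q)" by (metis odd_one dvd_abs_iff)
    moreover have "odd q" using step.hyps step.prems slope_in_01_iff by auto
    ultimately have "even r \<longleftrightarrow> odd x" using xy by auto
    moreover have "0 < card (T01.anc (T01.parent v))"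
      using T01.finite_anc[OF p(3)] T01.anc_self by (metis card_gt_0_iff empty_iff)
    then have "dist01 (slope 0 1) v = Suc (dist01 (slope 0 1) (T01.parent v))"
      using T01.card_anc_parent[OF step.hyps] p by (simp add: T01.tree_dist_root step.hyps)
    ultimately show ?case using step.IH[OF xy(1,4)] by simp
  qed
  then show ?thesis using assms by (simp add: depth_def slope_in_01_iff)
qed

lemma mobius_class_iff:
  assumes "\<bar>a * d - b * c\<bar> = 1" "s \<in> slope_class j k"
  shows "mobius a c b d s \<in> slope_class j' k' \<longleftrightarrow>
    (a * j + c * k) mod 2 = j' mod 2 \<and> (b * j + d * k) mod 2 = k' mod 2"
proof -
  obtain p q where s: "coprime p q" "s = slope p q" by (rule slope_cases)
  then have "p mod 2 = j mod 2" "q mod 2 = k mod 2"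
    using assms by (simp_all add: slope_in_class_iff)
  then have "(x * p + y * q) mod 2 = (x * j + y * k) mod 2" for x y
    by (intro mod_add_cong mod_mult_cong refl)
  then show ?thesis
    using s coprime_mobius[OF assms(1) s(1)] by (simp add: mobius_slope slope_in_class_iff)
qed

section \<open>Displacements of integral matrices\<close>

definition displacement :: "int \<Rightarrow> int \<Rightarrow> int \<Rightarrow> int \<Rightarrow> int \<Rightarrow> int \<Rightarrow> ereal"
  where "displacement j k a c b d = (INF v\<in>slope_class j k. slope_dist v (mobius a c b d v))"

lemma displacement_infinity:
  assumes "\<bar>a * d - b * c\<bar> = 1"
    and "\<not> ((a * j + c * k) mod 2 = j mod 2 \<and> (b * j + d * k) mod 2 = k mod 2)"
  shows "displacement j k a c b d = \<infinity>"
proof -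
  have "slope_dist v (mobius a c b d v) = \<infinity>" if "v \<in> slope_class j k" for v
    using mobius_class_iff[OF assms(1) that, of j k] assms(2) slope_dist_infinity[OF that] by blast
  then have "\<infinity> \<le> displacement j k a c b d"
    unfolding displacement_def by (intro INF_greatest) simp
  then show ?thesis by simp
qed

lemma displacement_01_eqI:
  assumes "\<And>v. v \<in> slope_class 0 1 \<Longrightarrow> mobius a c b d v \<in> slope_class 0 1"
    and "\<And>v. v \<in> slope_class 0 1 \<Longrightarrow> n \<le> dist01 v (mobius a c b d v)"
    and "y \<in> slope_class 0 1" "dist01 y (mobius a c b d y) = n"
  shows "displacement 0 1 a c b d = ereal (real n)"
  unfolding displacement_def
proof (rule antisym)
  show "(INF v\<in>slope_class 0 1. slope_dist v (mobius a c b d v)) \<le> ereal (real n)"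
    using assms by (intro INF_lower2[of y]) (simp_all add: slope_dist_01)
  show "ereal (real n) \<le> (INF v\<in>slope_class 0 1. slope_dist v (mobius a c b d v))"
    using assms by (intro INF_greatest) (simp add: slope_dist_01)
qed

text \<open>If the square of the matrix scales a vector \<open>v\<close> by \<open>e\<close>, it
  scales the image of \<open>v\<close> by \<open>e\<close> too. Were the two independent, the square
  would be scalar and its upper right entry \<open>c * (a + d)\<close> would vanish.\<close>

lemma mobius_no_2_cycle:
  assumes A: "\<bar>a * d - b * c\<bar> = 1" and nz: "c * (a + d) \<noteq> 0"
    and fix2: "mobius a c b d (mobius a c b d s) = s"
  shows "mobius a c b d s = s"
proof -
  obtain p q where s: "coprime p q" "s = slope p q" by (rule slope_cases)
  let ?p = "a * p + c * q" and ?q = "b * p + d * q"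
  have c1: "coprime ?p ?q" using coprime_mobius[OF A s(1)] .
  have c2: "coprime (a * ?p + c * ?q) (b * ?p + d * ?q)" using coprime_mobius[OF A c1] .
  have "slope (a * ?p + c * ?q) (b * ?p + d * ?q) = slope p q"
    using fix2 s c1 by (simp add: mobius_slope)
  then obtain e where e: "a * ?p + c * ?q = e * p" "b * ?p + d * ?q = e * q"
    using slope_eq_iff[OF c2 s(1)] by (metis mult_1 mult_minus1)
  have "a * (a * ?p + c * ?q) + c * (b * ?p + d * ?q) = e * ?p"
    unfolding e by (simp add: algebra_simps)
  then have "(a * (a * ?p + c * ?q) + c * (b * ?p + d * ?q)) * p = e * ?p * p"
    by (rule arg_cong)
  moreover have "(a * ?p + c * ?q) * ?p = e * ?p * p"
    unfolding e(1) by (simp only: mult.assoc mult.commute mult.left_commute)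
  \<comment> \<open>Eliminating the upper left entry of the square from the first-row equations
    leaves \<open>c * (a + d)\<close> times the determinant of the vector and its image.\<close>
  moreover have "(a * ?p + c * ?q) * ?p - (a * (a * ?p + c * ?q) + c * (b * ?p + d * ?q)) * p
      = c * (a + d) * (q * ?p - ?q * p)"
    by (simp add: algebra_simps)
  ultimately have "c * (a + d) * (q * ?p - ?q * p) = 0" by (simp only: diff_self)
  then have "?p * q = p * ?q" using nz by (simp add: mult.commute)
  then have "slope ?p ?q = slope p q" by (intro slope_eqI c1 s(1))
  then show ?thesis using s by (simp add: mobius_slope)
qed

lemma displacement_01:
  assumes A: "\<bar>a * d - b * c\<bar> = 1"
  shows "displacement 0 1 a c b d =
    (if even c \<and> odd d then
       if c * (a + d) = 0 then (if even (c div 2) then 0 else 1)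
       else N (c * (a + d)) (b * c + d^2) - N c d
     else \<infinity>)"
proof (cases "even c \<and> odd d")
  case False
  then have "displacement 0 1 a c b d = \<infinity>"
    by (intro displacement_infinity A) (auto simp: even_iff_mod_2_eq_zero odd_iff_mod_2_eq_one)
  then show ?thesis using False by (simp only: if_False)
next
  case True
  let ?f = "mobius a c b d" and ?o = "slope 0 1"
  have f_in: "?f v \<in> slope_class 0 1" if "v \<in> slope_class 0 1" for v
    using mobius_in_01 A True that by blast
  have isom: "dist01 (?f u) (?f v) = dist01 u v" if "u \<in> slope_class 0 1" "v \<in> slope_class 0 1" for u v
    using dist01_mobius[OF A that] f_in that by blast
  have c1: "coprime c d" using coprime_mobius[OF A, of 0 1] by simp
  have c2: "coprime (c * (a + d)) (b * c + d^2)"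
    using coprime_mobius[OF A c1] by (simp add: algebra_simps power2_eq_square)
  \<comment> \<open>The images of 0/1 are the second columns of the matrix and of its square, so the
    two values of \<open>N\<close> are \<open>dist01 ?o (?f (?f ?o))\<close> and
    \<open>dist01 ?o (?f ?o)\<close>.\<close>
  have fo: "?f ?o = slope c d" by (simp add: mobius_slope)
  have ffo: "?f (?f ?o) = slope (c * (a + d)) (b * c + d^2)"
    using c1 by (simp add: fo mobius_slope algebra_simps power2_eq_square)
  show ?thesis
  proof (cases "c * (a + d) = 0")
    case nz: False
    have d1: "N c d = ereal (real (dist01 ?o (?f ?o)))"
      using N_eq_depth[OF c1] True by (simp add: depth_def fo)
    have d2: "N (c * (a + d)) (b * c + d^2) = ereal (real (dist01 ?o (?f (?f ?o))))"
      using N_eq_depth[OF c2] True by (simp add: depth_def ffo)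
    obtain y where y: "y \<in> slope_class 0 1" "dist01 y (?f y) + dist01 ?o (?f ?o) = dist01 ?o (?f (?f ?o))"
      using T01.displacement_attained[of ?f ?o] f_in isom mobius_no_2_cycle[OF A nz] T01.root_in
      by blast
    have "displacement 0 1 a c b d = ereal (real (dist01 y (?f y)))"
    proof (rule displacement_01_eqI[OF f_in _ y(1)])
      fix v assume v: "v \<in> slope_class 0 1"
      then have "dist01 ?o (?f (?f ?o)) \<le> dist01 ?o (?f ?o) + dist01 v (?f v)"
        using T01.displacement_ge[of ?f ?o v] f_in isom T01.root_in by blast
      then show "dist01 y (?f y) \<le> dist01 v (?f v)" using y by simp
    qed simp_all
    also have "\<dots> = N (c * (a + d)) (b * c + d^2) - N c d"
      using y(2) unfolding d1 d2 by (simp flip: y(2))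
    finally show ?thesis using True nz by (simp only: if_True if_False simp_thms)
  next
    case z: True
    \<comment> \<open>A coprime pair with first entry 0 has second entry 1 or -1, so
      \<open>?f\<close> is an involution on the root and \<open>displacement_elliptic\<close>
      applies.\<close>
    have "\<bar>b * c + d^2\<bar> = 1" using c2 unfolding z by simp
    then have "b * c + d^2 = 1 \<or> b * c + d^2 = - 1" by linarith
    then have "?f (?f ?o) = ?o"
      unfolding ffo z using slope_uminus[of 0 1] by (metis minus_zero)
    then obtain y where y: "y \<in> slope_class 0 1" "dist01 y (?f y) = dist01 ?o (?f ?o) mod 2"
      using T01.displacement_elliptic[of ?f ?o] f_in isom T01.root_in by blast
    have "displacement 0 1 a c b d = ereal (real (dist01 ?o (?f ?o) mod 2))"
    proof (rule displacement_01_eqI[OF f_in _ y])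
      fix v assume v: "v \<in> slope_class 0 1"
      then have "even (dist01 v (?f v)) \<longleftrightarrow> even (dist01 ?o (?f ?o))"
        using T01.displacement_parity[of ?f v ?o] f_in isom T01.root_in by blast
      then show "dist01 ?o (?f ?o) mod 2 \<le> dist01 v (?f v)"
        by (cases "even (dist01 ?o (?f ?o))") (auto simp: odd_iff_mod_2_eq_one Suc_le_eq intro: Nat.gr0I)
    qed simp
    moreover obtain r where r: "c = 2 * r" using True by blast
    moreover have "even (dist01 ?o (?f ?o)) \<longleftrightarrow> even r"
      using even_depth_iff[of r d] c1 True unfolding r[symmetric] by (simp add: depth_def fo)
    ultimately show ?thesis
      using True z by (auto simp: odd_iff_mod_2_eq_one)
  qed
qed

text \<open>Substituting \<open>v = Q s\<close> moves the infimum to the component of 0/1, and the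
  isometry \<open>Q\<close> cancels. The primed matrix plays the role of \<open>A\<close> conjugated
  by \<open>Q\<close>.\<close>

lemma displacement_conj:
  assumes Q: "\<bar>qa * qd - qb * qc\<bar> = 1"
    and image: "mobius qa qc qb qd ` slope_class 0 1 = slope_class j k"
    and conj: "\<And>s. mobius a c b d (mobius qa qc qb qd s) = mobius qa qc qb qd (mobius a' c' b' d' s)"
  shows "displacement j k a c b d = displacement 0 1 a' c' b' d'"
  unfolding displacement_def image[symmetric] image_image conj slope_dist_mobius[OF Q] ..

lemma displacement_10:
  assumes A: "\<bar>a * d - b * c\<bar> = 1"
  shows "displacement 1 0 a c b d = displacement 0 1 d b c a"
proof (rule displacement_conj[of 0 0 1 1])
  have inv: "mobius 0 1 1 0 (mobius 0 1 1 0 s) = s" for s by (simp add: mobius_mobius)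
  show "mobius 0 1 1 0 ` slope_class 0 1 = slope_class 1 0"
  proof (intro equalityI subsetI)
    fix s assume "s \<in> slope_class 1 0"
    then have "mobius 0 1 1 0 s \<in> slope_class 0 1" by (subst mobius_class_iff[of 0 0 1 1]) auto
    then show "s \<in> mobius 0 1 1 0 ` slope_class 0 1" using inv by (metis imageI)
  qed (auto simp: mobius_class_iff[of 0 0 1 1])
  show "mobius a c b d (mobius 0 1 1 0 s) = mobius 0 1 1 0 (mobius d b c a s)" for s
    using A by (subst (1 2) mobius_mobius) (simp_all add: mult.commute)
qed simp

text \<open>The matrix with rows \<open>(0, 1)\<close> and \<open>(1, 1)\<close> carries 0/1 to 1/1;
  its inverse has rows \<open>(-1, 1)\<close> and \<open>(1, 0)\<close>.\<close>

lemma displacement_11: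
  assumes A: "\<bar>a * d - b * c\<bar> = 1"
  shows "displacement 1 1 a c b d = displacement 0 1 (d - c) (b + d - a - c) c (a + c)"
proof (rule displacement_conj[of 0 1 1 1])
  have inv: "mobius 0 1 1 1 (mobius (-1) 1 1 0 s) = s" for s by (simp add: mobius_mobius)
  show "mobius 0 1 1 1 ` slope_class 0 1 = slope_class 1 1"
  proof (intro equalityI subsetI)
    fix s assume "s \<in> slope_class 1 1"
    then have "mobius (-1) 1 1 0 s \<in> slope_class 0 1" by (subst mobius_class_iff[of "-1" 0 1 1]) auto
    then show "s \<in> mobius 0 1 1 1 ` slope_class 0 1" using inv by (metis imageI)
  qed (auto simp: mobius_class_iff[of 0 1 1 1])
  have "(d - c) * (a + c) - c * (b + d - a - c) = a * d - b * c" by (simp add: algebra_simps)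
  then show "mobius a c b d (mobius 0 1 1 1 s)
      = mobius 0 1 1 1 (mobius (d - c) (b + d - a - c) c (a + c) s)" for s
    using A by (subst (1 2) mobius_mobius) (simp_all add: algebra_simps)
qed simp

theorem corollary4p7:
  fixes lam mu :: "real \<Rightarrow> complex \<times> complex"
    and f :: "complex \<times> complex \<Rightarrow> complex \<times> complex"
    and a b c d :: int
  assumes "simple_closed_curve_on torus lam" and "simple_closed_curve_on torus mu"
    and "homology_basis lam mu"
    and "torus_diffeo f"
    and "homology_matrix lam mu f = vector [vector [a, c], vector [b, d]]"
  shows
    "min_displacement lam mu f 1 0 =
      (if odd a \<and> even b then
         if b * (a + d) = 0 then (if even (b div 2) then 0 else 1)
         else N (b * (a + d)) (a^2 + b * c) - N b a
       else \<infinity>)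
     \<and>
     min_displacement lam mu f 0 1 =
      (if even c \<and> odd d then
         if c * (a + d) = 0 then (if even (c div 2) then 0 else 1)
         else N (c * (a + d)) (b * c + d^2) - N c d
       else \<infinity>)
     \<and>
     min_displacement lam mu f 1 1 =
      (if odd (a + c) \<and> odd (b + d) then
         let e = (b - a) * (a + c) + (d - c) * (b + d) in
         if e = 0 then (if even ((b + d - a - c) div 2) then 0 else 1)
         else N e (a * (a + c) + c * (b + d)) - N (b + d - a - c) (a + c)
       else \<infinity>)"
proof -
  have A: "\<bar>a * d - b * c\<bar> = 1"
    using homology_matrix_det[OF assms] .
  have disp: "min_displacement lam mu f j k = displacement j k a c b d" for j k
    by (simp add: min_displacement_def displacement_def diffeo_slope_def matrix_slope_def
        mobius_def assms(5))
  have "\<bar>d * a - c * b\<bar> = 1" using A by (simp add: mult.commute)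
  note 10 = displacement_01[OF this]
  have "(d - c) * (a + c) - c * (b + d - a - c) = a * d - b * c" by (simp add: algebra_simps)
  with A have "\<bar>(d - c) * (a + c) - c * (b + d - a - c)\<bar> = 1" by simp
  note 11 = displacement_01[OF this]
  have parity: "even (b + d - a - c) \<and> odd (a + c) \<longleftrightarrow> odd (a + c) \<and> odd (b + d)" by auto
  \<comment> \<open>For the conjugate matrix, whose trace is still \<open>a + d\<close>, the first
    identity gives the upper right and the second the lower right entry of its square.\<close>
  have e: "(b + d - a - c) * (d - c + (a + c)) = (b - a) * (a + c) + (d - c) * (b + d)"
    "c * (b + d - a - c) + (a + c)^2 = a * (a + c) + c * (b + d)"
    by (simp_all add: algebra_simps power2_eq_square)
  have "min_displacement lam mu f 1 0 =
      (if odd a \<and> even b then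
         if b * (a + d) = 0 then (if even (b div 2) then 0 else 1)
         else N (b * (a + d)) (a^2 + b * c) - N b a
       else \<infinity>)"
    unfolding disp displacement_10[OF A] 10
    by (simp only: add.commute[of d a] mult.commute[of c b] add.commute[of "b * c" "a^2"]
        conj_commute[of "even b"])
  moreover have "min_displacement lam mu f 1 1 =
      (if odd (a + c) \<and> odd (b + d) then
         let e = (b - a) * (a + c) + (d - c) * (b + d) in
         if e = 0 then (if even ((b + d - a - c) div 2) then 0 else 1)
         else N e (a * (a + c) + c * (b + d)) - N (b + d - a - c) (a + c)
       else \<infinity>)"
    unfolding disp displacement_11[OF A] 11 parity e Let_def ..
  ultimately show ?thesis
    using displacement_01[OF A] unfolding disp by blast
qed

end
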